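(* Let $\mathbf{k}$ be a field, let $\phi : B\to B'$ be a map of $\mathbf{k}$-bialgebras, let $(E,\rho)$ be a right $B$-comodule algebra, let $(E',\rho')$ be a right $B'$-comodule algebra, and let $f:E\to E'$ be a map of comodule algebras over $\phi$. Then there is a canonical 2-cell filling the square with sides $f^*\times\phi^* : {}_E\mathcal{M}\times{}_B\mathcal{M}\to{}_{E'}\mathcal{M}\times{}_{B'}\mathcal{M}$, $\triangleleft : {}_E\mathcal{M}\times{}_B\mathcal{M}\to{}_E\mathcal{M}$, $\triangleleft' : {}_{E'}\mathcal{M}\times{}_{B'}\mathcal{M}\to{}_{E'}\mathcal{M}$ and $f^* : {}_E\mathcal{M}\to{}_{E'}\mathcal{M}$, that is, a natural transformation $$\alpha=\alpha^{f,\phi} : f^*\circ\triangleleft \Longrightarrow \triangleleft'\circ(f^*\times\phi^* ).$$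
   Context: Algebras are associative and unital; unadorned $\otimes$ is over $\mathbf{k}$. ${}_R\mathcal{M}$ denotes the category of left $R$-modules. A right $B$-comodule algebra is an algebra $E$ with a right $B$-coaction $\rho:E\to E\otimes B$ that is an algebra map; write $\rho(e)=\sum e_{(0)}\otimes e_{(1)}$ (similarly for $\rho'$). A map of comodule algebras over $\phi$ is an algebra map $f:E\to E'$ with $\rho'\circ f=(f\otimes\phi)\circ\rho$. The functor $\triangleleft:{}_E\mathcal{M}\times{}_B\mathcal{M}\to{}_E\mathcal{M}$ sends $(N,Q)$ to $N\triangleleft Q=N\otimes Q$ with left $E$-action $e(n\otimes q)=\sum e_{(0)}n\otimes e_{(1)}q$; it is a right action of the monoidal category ${}_B\mathcal{M}$ (with tensor product $\otimes$ and $B$-action $b(x\otimes y)=\sum b_{(1)}x\otimes b_{(2)}y$) on ${}_E\mathcal{M}$. The functor $\triangleleft'$ is defined in the same way for $(E',\rho')$ and $B'$. For an algebra map $g:A\to A'$, $g^*:{}_A\mathcal{M}\to{}_{A'}\mathcal{M}$ is extension of scalars, $g^*M=A'\otimes_A M$; this applies to both $f$ and $\phi$. *)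

theory Defs
  imports "HOL-Algebra.Module" "HOL-Algebra.Generated_Groups" "HOL-Algebra.Free_Abelian_Groups"
begin

section \<open>Left modules over a (not necessarily commutative) ring\<close>

text \<open>The library locale \<^locale>\<open>module\<close> requires a commutative base ring. The fields
  \<^const>\<open>monoid.mult\<close> and \<^const>\<open>one\<close> of a record representing a module carry no meaning.\<close>

locale left_module = R?: ring R + M?: abelian_group M
  for R :: "('r, 'c) ring_scheme" (structure) and M :: "('r, 'm, 'd) module_scheme" (structure) +
  assumes lsmult_closed:
      "\<lbrakk>a \<in> carrier R; x \<in> carrier M\<rbrakk> \<Longrightarrow> a \<odot>\<^bsub>M\<^esub> x \<in> carrier M"
    and lsmult_l_distr:
      "\<lbrakk>a \<in> carrier R; b \<in> carrier R; x \<in> carrier M\<rbrakk> \<Longrightarrow>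
        (a \<oplus>\<^bsub>R\<^esub> b) \<odot>\<^bsub>M\<^esub> x = a \<odot>\<^bsub>M\<^esub> x \<oplus>\<^bsub>M\<^esub> b \<odot>\<^bsub>M\<^esub> x"
    and lsmult_r_distr:
      "\<lbrakk>a \<in> carrier R; x \<in> carrier M; y \<in> carrier M\<rbrakk> \<Longrightarrow>
        a \<odot>\<^bsub>M\<^esub> (x \<oplus>\<^bsub>M\<^esub> y) = a \<odot>\<^bsub>M\<^esub> x \<oplus>\<^bsub>M\<^esub> a \<odot>\<^bsub>M\<^esub> y"
    and lsmult_assoc:
      "\<lbrakk>a \<in> carrier R; b \<in> carrier R; x \<in> carrier M\<rbrakk> \<Longrightarrow>
        (a \<otimes>\<^bsub>R\<^esub> b) \<odot>\<^bsub>M\<^esub> x = a \<odot>\<^bsub>M\<^esub> (b \<odot>\<^bsub>M\<^esub> x)"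
    and lsmult_one:
      "x \<in> carrier M \<Longrightarrow> \<one>\<^bsub>R\<^esub> \<odot>\<^bsub>M\<^esub> x = x"

definition lmod_hom ::
    "('r, 'c) ring_scheme \<Rightarrow> ('r, 'm, 'd) module_scheme \<Rightarrow> ('r, 'n, 'e) module_scheme \<Rightarrow> ('m \<Rightarrow> 'n) set" where
  "lmod_hom R M N = {h \<in> carrier M \<rightarrow>\<^sub>E carrier N.
      (\<forall>x\<in>carrier M. \<forall>y\<in>carrier M. h (x \<oplus>\<^bsub>M\<^esub> y) = h x \<oplus>\<^bsub>N\<^esub> h y) \<and>
      (\<forall>a\<in>carrier R. \<forall>x\<in>carrier M. h (a \<odot>\<^bsub>M\<^esub> x) = a \<odot>\<^bsub>N\<^esub> h x)}"


section \<open>Tensor products\<close>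

text \<open>For a right \<open>R\<close>-module \<open>X\<close>, whose action is given as a function \<open>ra x r\<close>, and a left
  \<open>R\<close>-module \<open>Y\<close>, the abelian group \<open>X \<otimes>\<^sub>R Y\<close> is the free abelian group on
  \<open>carrier X \<times> carrier Y\<close> modulo the subgroup generated by the relators; its elements are cosets.\<close>

type_synonym ('x, 'y) tens = "('x \<times> 'y \<Rightarrow>\<^sub>0 int) set"

definition tensor_relators ::
    "('r, 'c) ring_scheme \<Rightarrow> ('x, 'd) ring_scheme \<Rightarrow> ('x \<Rightarrow> 'r \<Rightarrow> 'x) \<Rightarrow> ('r, 'y, 'e) module_scheme
      \<Rightarrow> ('x, 'y) tens" where
  "tensor_relators R X ra Y =
     {frag_of (x \<oplus>\<^bsub>X\<^esub> x', y) - frag_of (x, y) - frag_of (x', y) | x x' y.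
        x \<in> carrier X \<and> x' \<in> carrier X \<and> y \<in> carrier Y}
   \<union> {frag_of (x, y \<oplus>\<^bsub>Y\<^esub> y') - frag_of (x, y) - frag_of (x, y') | x y y'.
        x \<in> carrier X \<and> y \<in> carrier Y \<and> y' \<in> carrier Y}
   \<union> {frag_of (ra x r, y) - frag_of (x, r \<odot>\<^bsub>Y\<^esub> y) | x r y.
        x \<in> carrier X \<and> r \<in> carrier R \<and> y \<in> carrier Y}"

definition tensor_subgroup ::
    "('r, 'c) ring_scheme \<Rightarrow> ('x, 'd) ring_scheme \<Rightarrow> ('x \<Rightarrow> 'r \<Rightarrow> 'x) \<Rightarrow> ('r, 'y, 'e) module_scheme
      \<Rightarrow> ('x, 'y) tens" where
  "tensor_subgroup R X ra Y =
     generate (free_Abelian_group (carrier X \<times> carrier Y)) (tensor_relators R X ra Y)"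

definition tensor_quot ::
    "('r, 'c) ring_scheme \<Rightarrow> ('x, 'd) ring_scheme \<Rightarrow> ('x \<Rightarrow> 'r \<Rightarrow> 'x) \<Rightarrow> ('r, 'y, 'e) module_scheme
      \<Rightarrow> ('x, 'y) tens monoid" where
  "tensor_quot R X ra Y =
     free_Abelian_group (carrier X \<times> carrier Y) Mod tensor_subgroup R X ra Y"

text \<open>The same group, written additively; only its additive structure is meaningful.\<close>

definition tensor ::
    "('r, 'c) ring_scheme \<Rightarrow> ('x, 'd) ring_scheme \<Rightarrow> ('x \<Rightarrow> 'r \<Rightarrow> 'x) \<Rightarrow> ('r, 'y, 'e) module_scheme
      \<Rightarrow> ('x, 'y) tens ring" where
  "tensor R X ra Y =
     \<lparr>carrier = carrier (tensor_quot R X ra Y),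
      monoid.mult = (\<lambda>_ _. undefined), one = undefined,
      ring.zero = \<one>\<^bsub>tensor_quot R X ra Y\<^esub>,
      ring.add = monoid.mult (tensor_quot R X ra Y)\<rparr>"

definition pure_tensor ::
    "('r, 'c) ring_scheme \<Rightarrow> ('x, 'd) ring_scheme \<Rightarrow> ('x \<Rightarrow> 'r \<Rightarrow> 'x) \<Rightarrow> ('r, 'y, 'e) module_scheme
      \<Rightarrow> 'x \<Rightarrow> 'y \<Rightarrow> ('x, 'y) tens" where
  "pure_tensor R X ra Y x y =
     tensor_subgroup R X ra Y #>\<^bsub>free_Abelian_group (carrier X \<times> carrier Y)\<^esub> frag_of (x, y)"

text \<open>For a balanced biadditive map \<open>\<beta>\<close> into an abelian group \<open>H\<close>, \<open>tensor_lift H \<beta>\<close> is the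
  induced homomorphism \<open>x \<otimes> y \<mapsto> \<beta> x y\<close>. If \<open>\<rho> e = \<Sum> e\<^sub>0 \<otimes> e\<^sub>1\<close> then
  \<open>tensor_lift H (\<lambda>e\<^sub>0 e\<^sub>1. t e\<^sub>0 e\<^sub>1) (\<rho> e)\<close> is the Sweedler expression \<open>\<Sum> t e\<^sub>0 e\<^sub>1\<close>.\<close>

definition frag_eval :: "('h, 'c) ring_scheme \<Rightarrow> ('x \<Rightarrow> 'y \<Rightarrow> 'h) \<Rightarrow> ('x \<times> 'y \<Rightarrow>\<^sub>0 int) \<Rightarrow> 'h" where
  "frag_eval H \<beta> t =
     (\<Oplus>\<^bsub>H\<^esub>p\<in>Poly_Mapping.keys t. [Poly_Mapping.lookup t p] \<cdot>\<^bsub>H\<^esub> \<beta> (fst p) (snd p))"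

definition tensor_lift :: "('h, 'c) ring_scheme \<Rightarrow> ('x \<Rightarrow> 'y \<Rightarrow> 'h) \<Rightarrow> ('x, 'y) tens \<Rightarrow> 'h" where
  "tensor_lift H \<beta> u = the_elem (frag_eval H \<beta> ` u)"


subsection \<open>Tensor products over the ground field\<close>

definition kpure ::
    "('k, 'c) ring_scheme \<Rightarrow> ('k, 'x, 'd) module_scheme \<Rightarrow> ('k, 'y, 'e) module_scheme
      \<Rightarrow> 'x \<Rightarrow> 'y \<Rightarrow> ('x, 'y) tens" where
  "kpure k X Y = pure_tensor k X (\<lambda>x c. c \<odot>\<^bsub>X\<^esub> x) Y"

definition kgroup ::
    "('k, 'c) ring_scheme \<Rightarrow> ('k, 'x, 'd) module_scheme \<Rightarrow> ('k, 'y, 'e) module_scheme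
      \<Rightarrow> ('x, 'y) tens ring" where
  "kgroup k X Y = tensor k X (\<lambda>x c. c \<odot>\<^bsub>X\<^esub> x) Y"

definition ktensor ::
    "('k, 'c) ring_scheme \<Rightarrow> ('k, 'x, 'd) module_scheme \<Rightarrow> ('k, 'y, 'e) module_scheme
      \<Rightarrow> ('k, ('x, 'y) tens) module" where
  "ktensor k X Y = ring.extend (kgroup k X Y)
     (module.fields (\<lambda>c. tensor_lift (kgroup k X Y) (\<lambda>x y. kpure k X Y (c \<odot>\<^bsub>X\<^esub> x) y)))"

definition tensor_algebra ::
    "('k, 'c) ring_scheme \<Rightarrow> ('k, 'a, 'd) module_scheme \<Rightarrow> ('k, 'b, 'e) module_scheme
      \<Rightarrow> ('k, ('a, 'b) tens) module" where
  "tensor_algebra k A B = (ktensor k A B)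
     \<lparr>monoid.mult := (\<lambda>u v. tensor_lift (kgroup k A B) (\<lambda>a b.
          tensor_lift (kgroup k A B) (\<lambda>a' b'. kpure k A B (a \<otimes>\<^bsub>A\<^esub> a') (b \<otimes>\<^bsub>B\<^esub> b')) v) u),
      one := kpure k A B \<one>\<^bsub>A\<^esub> \<one>\<^bsub>B\<^esub>\<rparr>"


section \<open>Algebras, bialgebras and comodule algebras\<close>

definition k_algebra :: "('k, 'c) ring_scheme \<Rightarrow> ('k, 'a, 'd) module_scheme \<Rightarrow> bool" where
  "k_algebra k A \<longleftrightarrow> ring A \<and> module k A \<and>
     (\<forall>c\<in>carrier k. \<forall>x\<in>carrier A. \<forall>y\<in>carrier A.
        (c \<odot>\<^bsub>A\<^esub> x) \<otimes>\<^bsub>A\<^esub> y = c \<odot>\<^bsub>A\<^esub> (x \<otimes>\<^bsub>A\<^esub> y) \<and>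
        x \<otimes>\<^bsub>A\<^esub> (c \<odot>\<^bsub>A\<^esub> y) = c \<odot>\<^bsub>A\<^esub> (x \<otimes>\<^bsub>A\<^esub> y))"

definition algebra_map ::
    "('k, 'c) ring_scheme \<Rightarrow> ('k, 'a, 'd) module_scheme \<Rightarrow> ('k, 'b, 'e) module_scheme
      \<Rightarrow> ('a \<Rightarrow> 'b) \<Rightarrow> bool" where
  "algebra_map k A B h \<longleftrightarrow> h \<in> ring_hom A B \<and>
     (\<forall>c\<in>carrier k. \<forall>x\<in>carrier A. h (c \<odot>\<^bsub>A\<^esub> x) = c \<odot>\<^bsub>B\<^esub> h x)"

record ('k, 'b) bialgebra = "('k, 'b) module" +
  comult :: "'b \<Rightarrow> ('b, 'b) tens"
  counit :: "'b \<Rightarrow> 'k"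

text \<open>A right coaction \<open>\<rho> : V \<rightarrow> V \<otimes> B\<close>. Coassociativity is stated in \<open>V \<otimes> (B \<otimes> B)\<close>, that is
  \<open>\<Sum> e\<^sub>0\<^sub>0 \<otimes> (e\<^sub>0\<^sub>1 \<otimes> e\<^sub>1) = \<Sum> e\<^sub>0 \<otimes> \<Delta>(e\<^sub>1)\<close>. Linearity of \<open>\<rho>\<close> is not part of this predicate.\<close>

definition coaction_laws ::
    "('k, 'c) ring_scheme \<Rightarrow> ('k, 'b, 'z) bialgebra_scheme \<Rightarrow> ('k, 'v, 'd) module_scheme
      \<Rightarrow> ('v \<Rightarrow> ('v, 'b) tens) \<Rightarrow> bool" where
  "coaction_laws k B V \<rho> \<longleftrightarrow>
     (let BB = ktensor k B B; T = kgroup k V BB in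
       (\<forall>e\<in>carrier V.
          tensor_lift T (\<lambda>e0 e1. tensor_lift T
              (\<lambda>e00 e01. kpure k V BB e00 (kpure k B B e01 e1)) (\<rho> e0)) (\<rho> e)
          = tensor_lift T (\<lambda>e0 e1. kpure k V BB e0 (comult B e1)) (\<rho> e))) \<and>
     (\<forall>e\<in>carrier V. tensor_lift V (\<lambda>e0 e1. counit B e1 \<odot>\<^bsub>V\<^esub> e0) (\<rho> e) = e)"

definition is_bialgebra :: "('k, 'c) ring_scheme \<Rightarrow> ('k, 'b, 'z) bialgebra_scheme \<Rightarrow> bool" where
  "is_bialgebra k B \<longleftrightarrow> k_algebra k B \<and>
     algebra_map k B (tensor_algebra k B B) (comult B) \<and>
     counit B \<in> ring_hom B k \<and>
     (\<forall>c\<in>carrier k. \<forall>b\<in>carrier B. counit B (c \<odot>\<^bsub>B\<^esub> b) = c \<otimes>\<^bsub>k\<^esub> counit B b) \<and>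
     coaction_laws k B B (comult B) \<and>
     (\<forall>b\<in>carrier B. tensor_lift B (\<lambda>b1 b2. counit B b1 \<odot>\<^bsub>B\<^esub> b2) (comult B b) = b)"

definition bialgebra_map ::
    "('k, 'c) ring_scheme \<Rightarrow> ('k, 'b, 'z) bialgebra_scheme \<Rightarrow> ('k, 'd, 'w) bialgebra_scheme
      \<Rightarrow> ('b \<Rightarrow> 'd) \<Rightarrow> bool" where
  "bialgebra_map k B B' \<phi> \<longleftrightarrow> algebra_map k B B' \<phi> \<and>
     (\<forall>b\<in>carrier B. comult B' (\<phi> b) =
        tensor_lift (kgroup k B' B') (\<lambda>b1 b2. kpure k B' B' (\<phi> b1) (\<phi> b2)) (comult B b)) \<and>
     (\<forall>b\<in>carrier B. counit B' (\<phi> b) = counit B b)"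

definition comodule_algebra ::
    "('k, 'c) ring_scheme \<Rightarrow> ('k, 'b, 'z) bialgebra_scheme \<Rightarrow> ('k, 'e, 'd) module_scheme
      \<Rightarrow> ('e \<Rightarrow> ('e, 'b) tens) \<Rightarrow> bool" where
  "comodule_algebra k B E \<rho> \<longleftrightarrow> k_algebra k E \<and>
     algebra_map k E (tensor_algebra k E B) \<rho> \<and> coaction_laws k B E \<rho>"

definition comodule_algebra_map ::
    "('k, 'c) ring_scheme \<Rightarrow> ('k, 'd, 'w) bialgebra_scheme
      \<Rightarrow> ('k, 'e, 'v) module_scheme \<Rightarrow> ('e \<Rightarrow> ('e, 'b) tens)
      \<Rightarrow> ('k, 'g, 'u) module_scheme \<Rightarrow> ('g \<Rightarrow> ('g, 'd) tens)
      \<Rightarrow> ('b \<Rightarrow> 'd) \<Rightarrow> ('e \<Rightarrow> 'g) \<Rightarrow> bool" where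
  "comodule_algebra_map k B' E \<rho> E' \<rho>' \<phi> f \<longleftrightarrow> algebra_map k E E' f \<and>
     (\<forall>e\<in>carrier E. \<rho>' (f e) =
        tensor_lift (kgroup k E' B') (\<lambda>e0 e1. kpure k E' B' (f e0) (\<phi> e1)) (\<rho> e))"


section \<open>Categories, functors and natural transformations\<close>

record ('o, 'a) category =
  Obj :: "'o set"
  Arr :: "'o \<Rightarrow> 'o \<Rightarrow> 'a set"
  Ide :: "'o \<Rightarrow> 'a"
  Cmp :: "'o \<Rightarrow> 'o \<Rightarrow> 'o \<Rightarrow> 'a \<Rightarrow> 'a \<Rightarrow> 'a"

definition is_category :: "('o, 'a) category \<Rightarrow> bool" where
  "is_category C \<longleftrightarrow>
     (\<forall>X\<in>Obj C. Ide C X \<in> Arr C X X) \<and>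
     (\<forall>X\<in>Obj C. \<forall>Y\<in>Obj C. \<forall>Z\<in>Obj C. \<forall>h\<in>Arr C X Y. \<forall>g\<in>Arr C Y Z. Cmp C X Y Z g h \<in> Arr C X Z) \<and>
     (\<forall>X\<in>Obj C. \<forall>Y\<in>Obj C. \<forall>h\<in>Arr C X Y.
        Cmp C X X Y h (Ide C X) = h \<and> Cmp C X Y Y (Ide C Y) h = h) \<and>
     (\<forall>W\<in>Obj C. \<forall>X\<in>Obj C. \<forall>Y\<in>Obj C. \<forall>Z\<in>Obj C.
        \<forall>h\<in>Arr C W X. \<forall>g\<in>Arr C X Y. \<forall>l\<in>Arr C Y Z.
          Cmp C W Y Z l (Cmp C W X Y g h) = Cmp C W X Z (Cmp C X Y Z l g) h)"

definition prod_category ::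
    "('o, 'a) category \<Rightarrow> ('p, 'b) category \<Rightarrow> ('o \<times> 'p, 'a \<times> 'b) category" where
  "prod_category C D =
     \<lparr>Obj = Obj C \<times> Obj D,
      Arr = (\<lambda>X Y. Arr C (fst X) (fst Y) \<times> Arr D (snd X) (snd Y)),
      Ide = (\<lambda>X. (Ide C (fst X), Ide D (snd X))),
      Cmp = (\<lambda>X Y Z g h. (Cmp C (fst X) (fst Y) (fst Z) (fst g) (fst h),
                          Cmp D (snd X) (snd Y) (snd Z) (snd g) (snd h)))\<rparr>"

record ('o, 'a, 'p, 'b) cfunctor =
  FObj :: "'o \<Rightarrow> 'p"
  FArr :: "'o \<Rightarrow> 'o \<Rightarrow> 'a \<Rightarrow> 'b"

definition is_functor ::
    "('o, 'a) category \<Rightarrow> ('p, 'b) category \<Rightarrow> ('o, 'a, 'p, 'b) cfunctor \<Rightarrow> bool" where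
  "is_functor C D F \<longleftrightarrow> is_category C \<and> is_category D \<and>
     (\<forall>X\<in>Obj C. FObj F X \<in> Obj D) \<and>
     (\<forall>X\<in>Obj C. \<forall>Y\<in>Obj C. \<forall>h\<in>Arr C X Y. FArr F X Y h \<in> Arr D (FObj F X) (FObj F Y)) \<and>
     (\<forall>X\<in>Obj C. FArr F X X (Ide C X) = Ide D (FObj F X)) \<and>
     (\<forall>X\<in>Obj C. \<forall>Y\<in>Obj C. \<forall>Z\<in>Obj C. \<forall>h\<in>Arr C X Y. \<forall>g\<in>Arr C Y Z.
        FArr F X Z (Cmp C X Y Z g h)
        = Cmp D (FObj F X) (FObj F Y) (FObj F Z) (FArr F Y Z g) (FArr F X Y h))"

definition functor_comp ::
    "('p, 'b, 'q, 'c) cfunctor \<Rightarrow> ('o, 'a, 'p, 'b) cfunctor \<Rightarrow> ('o, 'a, 'q, 'c) cfunctor"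
    (infixr \<open>\<circ>\<^sub>F\<close> 70) where
  "G \<circ>\<^sub>F F =
     \<lparr>FObj = (\<lambda>X. FObj G (FObj F X)),
      FArr = (\<lambda>X Y h. FArr G (FObj F X) (FObj F Y) (FArr F X Y h))\<rparr>"

definition functor_prod ::
    "('o, 'a, 'p, 'b) cfunctor \<Rightarrow> ('q, 'c, 'r, 'd) cfunctor
      \<Rightarrow> ('o \<times> 'q, 'a \<times> 'c, 'p \<times> 'r, 'b \<times> 'd) cfunctor"
    (infixr \<open>\<times>\<^sub>F\<close> 75) where
  "F \<times>\<^sub>F G =
     \<lparr>FObj = (\<lambda>X. (FObj F (fst X), FObj G (snd X))),
      FArr = (\<lambda>X Y h. (FArr F (fst X) (fst Y) (fst h), FArr G (snd X) (snd Y) (snd h)))\<rparr>"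

text \<open>The category of left \<open>R\<close>-modules whose carrier is a set of elements of the type \<open>'m\<close>.
  Arrows are extensional functions on the carrier of their source.\<close>

definition LMod :: "('r, 'c) ring_scheme \<Rightarrow> (('r, 'm) module, 'm \<Rightarrow> 'm) category" where
  "LMod R =
     \<lparr>Obj = {M. left_module R M},
      Arr = lmod_hom R,
      Ide = (\<lambda>M. \<lambda>x\<in>carrier M. x),
      Cmp = (\<lambda>M N P g h. compose (carrier M) g h)\<rparr>"

text \<open>A natural transformation between two functors with values in left \<open>R\<close>-modules. The element
  types \<open>'m\<close> and \<open>'n\<close> of the values of the two functors may differ, so that the components are
  \<open>R\<close>-linear maps between modules on different types; this is what is needed to compare functors
  built from tensor products, whose elements live in different types.\<close>

definition module_nat_trans ::
    "('o, 'a) category \<Rightarrow> ('r, 'c) ring_scheme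
      \<Rightarrow> ('o, 'a, ('r, 'm) module, 'm \<Rightarrow> 'm) cfunctor \<Rightarrow> ('o, 'a, ('r, 'n) module, 'n \<Rightarrow> 'n) cfunctor
      \<Rightarrow> ('o \<Rightarrow> 'm \<Rightarrow> 'n) \<Rightarrow> bool" where
  "module_nat_trans C R F G \<alpha> \<longleftrightarrow>
     is_functor C (LMod R) F \<and> is_functor C (LMod R) G \<and>
     (\<forall>X\<in>Obj C. \<alpha> X \<in> lmod_hom R (FObj F X) (FObj G X)) \<and>
     (\<forall>X\<in>Obj C. \<forall>Y\<in>Obj C. \<forall>h\<in>Arr C X Y.
        compose (carrier (FObj F X)) (\<alpha> Y) (FArr F X Y h)
        = compose (carrier (FObj F X)) (FArr G X Y h) (\<alpha> X))"


section \<open>Extension of scalars\<close>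

definition ext_group ::
    "('a, 'c) ring_scheme \<Rightarrow> ('b, 'd) ring_scheme \<Rightarrow> ('a \<Rightarrow> 'b) \<Rightarrow> ('a, 'm, 'z) module_scheme
      \<Rightarrow> ('b, 'm) tens ring" where
  "ext_group A A' g M = tensor A A' (\<lambda>x a. x \<otimes>\<^bsub>A'\<^esub> g a) M"

definition ext_pure ::
    "('a, 'c) ring_scheme \<Rightarrow> ('b, 'd) ring_scheme \<Rightarrow> ('a \<Rightarrow> 'b) \<Rightarrow> ('a, 'm, 'z) module_scheme
      \<Rightarrow> 'b \<Rightarrow> 'm \<Rightarrow> ('b, 'm) tens" where
  "ext_pure A A' g M = pure_tensor A A' (\<lambda>x a. x \<otimes>\<^bsub>A'\<^esub> g a) M"

definition ext_obj ::
    "('a, 'c) ring_scheme \<Rightarrow> ('b, 'd) ring_scheme \<Rightarrow> ('a \<Rightarrow> 'b) \<Rightarrow> ('a, 'm) module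
      \<Rightarrow> ('b, ('b, 'm) tens) module" where
  "ext_obj A A' g M = ring.extend (ext_group A A' g M)
     (module.fields (\<lambda>a. tensor_lift (ext_group A A' g M) (\<lambda>x m. ext_pure A A' g M (a \<otimes>\<^bsub>A'\<^esub> x) m)))"

definition ext_scalars ::
    "('a, 'c) ring_scheme \<Rightarrow> ('b, 'd) ring_scheme \<Rightarrow> ('a \<Rightarrow> 'b)
      \<Rightarrow> (('a, 'm) module, 'm \<Rightarrow> 'm, ('b, ('b, 'm) tens) module, ('b, 'm) tens \<Rightarrow> ('b, 'm) tens) cfunctor" where
  "ext_scalars A A' g =
     \<lparr>FObj = ext_obj A A' g,
      FArr = (\<lambda>M N h. \<lambda>u\<in>carrier (ext_obj A A' g M).
                tensor_lift (ext_group A A' g N) (\<lambda>x m. ext_pure A A' g N x (h m)) u)\<rparr>"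

text \<open>The unit \<open>m \<mapsto> 1 \<otimes> m\<close> of the adjunction between extension and restriction of scalars.\<close>

definition ext_unit ::
    "('a, 'c) ring_scheme \<Rightarrow> ('b, 'd) ring_scheme \<Rightarrow> ('a \<Rightarrow> 'b) \<Rightarrow> ('a, 'm, 'z) module_scheme
      \<Rightarrow> 'm \<Rightarrow> ('b, 'm) tens" where
  "ext_unit A A' g M m = ext_pure A A' g M \<one>\<^bsub>A'\<^esub> m"


section \<open>The action of \<open>B\<close>-modules on \<open>E\<close>-modules\<close>

text \<open>The \<open>k\<close>-module underlying a module over the \<open>k\<close>-algebra \<open>A\<close>.\<close>

definition underlying :: "('k, 'a, 'c) module_scheme \<Rightarrow> ('a, 'm) module \<Rightarrow> ('k, 'm) module" where
  "underlying A M = ring.extend (ring.truncate M) (module.fields (\<lambda>c m. (c \<odot>\<^bsub>A\<^esub> \<one>\<^bsub>A\<^esub>) \<odot>\<^bsub>M\<^esub> m))"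

definition act_group ::
    "('k, 'c) ring_scheme \<Rightarrow> ('k, 'b, 'd) module_scheme \<Rightarrow> ('k, 'e, 'z) module_scheme
      \<Rightarrow> ('e, 'n) module \<Rightarrow> ('b, 'q) module \<Rightarrow> ('n, 'q) tens ring" where
  "act_group k B E N Q = kgroup k (underlying E N) (underlying B Q)"

definition act_pure ::
    "('k, 'c) ring_scheme \<Rightarrow> ('k, 'b, 'd) module_scheme \<Rightarrow> ('k, 'e, 'z) module_scheme
      \<Rightarrow> ('e, 'n) module \<Rightarrow> ('b, 'q) module \<Rightarrow> 'n \<Rightarrow> 'q \<Rightarrow> ('n, 'q) tens" where
  "act_pure k B E N Q = kpure k (underlying E N) (underlying B Q)"

definition act_obj ::
    "('k, 'c) ring_scheme \<Rightarrow> ('k, 'b, 'd) module_scheme \<Rightarrow> ('k, 'e, 'z) module_scheme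
      \<Rightarrow> ('e \<Rightarrow> ('e, 'b) tens)
      \<Rightarrow> ('e, 'n) module \<Rightarrow> ('b, 'q) module \<Rightarrow> ('e, ('n, 'q) tens) module" where
  "act_obj k B E \<rho> N Q = ring.extend (act_group k B E N Q)
     (module.fields (\<lambda>e w. tensor_lift (act_group k B E N Q) (\<lambda>e0 e1.
        tensor_lift (act_group k B E N Q)
          (\<lambda>n q. act_pure k B E N Q (e0 \<odot>\<^bsub>N\<^esub> n) (e1 \<odot>\<^bsub>Q\<^esub> q)) w) (\<rho> e)))"

definition act ::
    "('k, 'c) ring_scheme \<Rightarrow> ('k, 'b, 'd) module_scheme \<Rightarrow> ('k, 'e, 'z) module_scheme
      \<Rightarrow> ('e \<Rightarrow> ('e, 'b) tens)
      \<Rightarrow> (('e, 'n) module \<times> ('b, 'q) module, ('n \<Rightarrow> 'n) \<times> ('q \<Rightarrow> 'q),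
          ('e, ('n, 'q) tens) module, ('n, 'q) tens \<Rightarrow> ('n, 'q) tens) cfunctor" where
  "act k B E \<rho> =
     \<lparr>FObj = (\<lambda>(N, Q). act_obj k B E \<rho> N Q),
      FArr = (\<lambda>(N, Q) (N', Q') (g, h). \<lambda>w\<in>carrier (act_obj k B E \<rho> N Q).
                tensor_lift (act_group k B E N' Q') (\<lambda>n q. act_pure k B E N' Q' (g n) (h q)) w)\<rparr>"

end

theory Submission
  imports Defs
begin

text \<open>
  Write \<open>\<eta>\<close> for the unit \<open>m \<mapsto> 1 \<otimes> m\<close> of extension of scalars. A natural map out of \<open>f\<^sup>*(N \<triangleleft> Q)\<close> is the
  same, by the universal property of extension of scalars, as a natural \<open>f\<close>-semilinear map out of
  \<open>N \<triangleleft> Q\<close>. The evident candidate is \<open>\<theta> = \<eta>\<^sub>N \<otimes> \<eta>\<^sub>Q : N \<otimes> Q \<rightarrow> f\<^sup>*N \<otimes> \<phi>\<^sup>*Q\<close>, and the transformation is its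
  adjunct \<open>\<alpha>(x \<otimes> w) = x \<cdot> \<theta>(w)\<close>; in Sweedler notation
  \<open>\<alpha>(x \<otimes> (n \<otimes> q)) = \<Sum> (x\<^sub>0 \<otimes> n) \<otimes> (x\<^sub>1 \<otimes> q)\<close>. Since \<open>f\<^sup>*(N \<triangleleft> Q)\<close> is generated over \<open>E'\<close> by the elements
  \<open>1 \<otimes> (n \<otimes> q)\<close>, the transformation is determined by what it does there.

  The only point with content is that \<open>\<theta>\<close> is semilinear (\<open>act_map\<close>). The module \<open>N \<otimes> Q\<close> is acted on by
  the whole algebra \<open>E \<otimes> B\<close>, and \<open>E\<close> acts through the algebra map \<open>\<rho>\<close>. As \<open>\<eta>\<^sub>N\<close> is \<open>f\<close>-semilinear and
  \<open>\<eta>\<^sub>Q\<close> is \<open>\<phi>\<close>-semilinear, \<open>\<theta>(u \<cdot> w) = (f \<otimes> \<phi>)(u) \<cdot> \<theta>(w)\<close> for all \<open>u\<close> in \<open>E \<otimes> B\<close>: both sides are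
  biadditive, so pure tensors suffice (\<open>tensor_map_bilinear\<close>). For \<open>u = \<rho>(e)\<close> the compatibility
  \<open>\<rho>' \<circ> f = (f \<otimes> \<phi>) \<circ> \<rho>\<close> turns this into \<open>\<theta>(e \<cdot> w) = f(e) \<cdot> \<theta>(w)\<close>.

  Naturality in \<open>g : N \<rightarrow> N'\<close> and \<open>h : Q \<rightarrow> Q'\<close> is checked on generators: linear maps out of an extension
  of scalars are determined on the elements \<open>1 \<otimes> m\<close> (\<open>ext_obj_linear_ext\<close>) and additive maps out of a
  tensor product on pure tensors (\<open>tensor_ext\<close>); both composites send \<open>1 \<otimes> (n \<otimes> q)\<close> to
  \<open>(1 \<otimes> g(n)) \<otimes> (1 \<otimes> h(q))\<close>. The same two principles
  show that extension of scalars and \<open>\<triangleleft>\<close> are functors with values in modules.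

  All of this rests on the universal property of the tensor product, proved for its construction
  as a quotient of a free abelian group in the locale \<open>tensor_pair\<close>.
\<close>

section \<open>Additive and balanced maps\<close>

text \<open>Additive maps are kept non-extensional, so that they can be composed and lifted as plain
  functions; restriction to carriers happens only when arrows of module categories are formed.\<close>

definition add_hom :: "('g, 'c) ring_scheme \<Rightarrow> ('h, 'd) ring_scheme \<Rightarrow> ('g \<Rightarrow> 'h) set" where
  "add_hom G H = {h \<in> carrier G \<rightarrow> carrier H.
      \<forall>x\<in>carrier G. \<forall>y\<in>carrier G. h (x \<oplus>\<^bsub>G\<^esub> y) = h x \<oplus>\<^bsub>H\<^esub> h y}"

lemma add_homI:
  assumes "\<And>x. x \<in> carrier G \<Longrightarrow> h x \<in> carrier H"
    and "\<And>x y. \<lbrakk>x \<in> carrier G; y \<in> carrier G\<rbrakk> \<Longrightarrow> h (x \<oplus>\<^bsub>G\<^esub> y) = h x \<oplus>\<^bsub>H\<^esub> h y"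
  shows "h \<in> add_hom G H"
  using assms by (auto simp: add_hom_def)

lemma add_hom_closed: "\<lbrakk>h \<in> add_hom G H; x \<in> carrier G\<rbrakk> \<Longrightarrow> h x \<in> carrier H"
  by (auto simp: add_hom_def)

lemma add_hom_add:
  "\<lbrakk>h \<in> add_hom G H; x \<in> carrier G; y \<in> carrier G\<rbrakk> \<Longrightarrow> h (x \<oplus>\<^bsub>G\<^esub> y) = h x \<oplus>\<^bsub>H\<^esub> h y"
  by (auto simp: add_hom_def)

lemma add_hom_zero:
  assumes "abelian_group G" "abelian_group H" "h \<in> add_hom G H"
  shows "h \<zero>\<^bsub>G\<^esub> = \<zero>\<^bsub>H\<^esub>"
proof -
  interpret G: abelian_group G by fact
  interpret H: abelian_group H by fact
  have "h \<zero>\<^bsub>G\<^esub> \<oplus>\<^bsub>H\<^esub> h \<zero>\<^bsub>G\<^esub> = h \<zero>\<^bsub>G\<^esub>"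
    using add_hom_add[OF assms(3), of "\<zero>\<^bsub>G\<^esub>" "\<zero>\<^bsub>G\<^esub>"] by simp
  then show ?thesis
    using add_hom_closed[OF assms(3), of "\<zero>\<^bsub>G\<^esub>"] by (metis G.zero_closed H.add.r_cancel_one')
qed

lemma add_hom_comp:
  "\<lbrakk>g \<in> add_hom G H; h \<in> add_hom H K\<rbrakk> \<Longrightarrow> (\<lambda>x. h (g x)) \<in> add_hom G K"
  by (auto simp: add_hom_def Pi_iff)

lemma add_hom_plus:
  assumes "abelian_group H" "g \<in> add_hom G H" "h \<in> add_hom G H"
  shows "(\<lambda>x. g x \<oplus>\<^bsub>H\<^esub> h x) \<in> add_hom G H"
proof -
  interpret H: abelian_group H by fact
  show ?thesis
    using assms(2,3) by (auto simp: add_hom_def Pi_iff H.a_ac)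
qed

definition balanced ::
    "('r, 'c) ring_scheme \<Rightarrow> ('x, 'd) ring_scheme \<Rightarrow> ('x \<Rightarrow> 'r \<Rightarrow> 'x) \<Rightarrow> ('r, 'y, 'e) module_scheme
      \<Rightarrow> ('h, 'f) ring_scheme \<Rightarrow> ('x \<Rightarrow> 'y \<Rightarrow> 'h) \<Rightarrow> bool" where
  "balanced R X ra Y H \<beta> \<longleftrightarrow>
     (\<forall>x\<in>carrier X. \<beta> x \<in> add_hom Y H) \<and>
     (\<forall>y\<in>carrier Y. (\<lambda>x. \<beta> x y) \<in> add_hom X H) \<and>
     (\<forall>x\<in>carrier X. \<forall>r\<in>carrier R. \<forall>y\<in>carrier Y. \<beta> (ra x r) y = \<beta> x (r \<odot>\<^bsub>Y\<^esub> y))"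

lemma balancedI:
  assumes "\<And>x. x \<in> carrier X \<Longrightarrow> \<beta> x \<in> add_hom Y H"
    and "\<And>y. y \<in> carrier Y \<Longrightarrow> (\<lambda>x. \<beta> x y) \<in> add_hom X H"
    and "\<And>x r y. \<lbrakk>x \<in> carrier X; r \<in> carrier R; y \<in> carrier Y\<rbrakk> \<Longrightarrow> \<beta> (ra x r) y = \<beta> x (r \<odot>\<^bsub>Y\<^esub> y)"
  shows "balanced R X ra Y H \<beta>"
  using assms by (auto simp: balanced_def)

lemma balanced_right: "\<lbrakk>balanced R X ra Y H \<beta>; x \<in> carrier X\<rbrakk> \<Longrightarrow> \<beta> x \<in> add_hom Y H"
  by (auto simp: balanced_def)

lemma balanced_left: "\<lbrakk>balanced R X ra Y H \<beta>; y \<in> carrier Y\<rbrakk> \<Longrightarrow> (\<lambda>x. \<beta> x y) \<in> add_hom X H"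
  by (auto simp: balanced_def)

lemma balanced_swap:
  "\<lbrakk>balanced R X ra Y H \<beta>; x \<in> carrier X; r \<in> carrier R; y \<in> carrier Y\<rbrakk>
    \<Longrightarrow> \<beta> (ra x r) y = \<beta> x (r \<odot>\<^bsub>Y\<^esub> y)"
  by (auto simp: balanced_def)

lemma balanced_closed:
  "\<lbrakk>balanced R X ra Y H \<beta>; x \<in> carrier X; y \<in> carrier Y\<rbrakk> \<Longrightarrow> \<beta> x y \<in> carrier H"
  by (meson add_hom_closed balanced_right)

section \<open>The universal property of the tensor product\<close>

lemma frag_eval_add:
  assumes H: "abelian_group H"
    and \<beta>: "\<And>x y. (x, y) \<in> S \<Longrightarrow> \<beta> x y \<in> carrier H"
    and s: "Poly_Mapping.keys s \<subseteq> S" and t: "Poly_Mapping.keys t \<subseteq> S"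
  shows "frag_eval H \<beta> (s + t) = frag_eval H \<beta> s \<oplus>\<^bsub>H\<^esub> frag_eval H \<beta> t"
proof -
  interpret H: abelian_group H by fact
  have zp: "[(0::int)] \<cdot>\<^bsub>H\<^esub> x = \<zero>\<^bsub>H\<^esub>" for x
    by (simp add: add_pow_def)
  let ?K = "Poly_Mapping.keys s \<union> Poly_Mapping.keys t"
  have *: "frag_eval H \<beta> u = (\<Oplus>\<^bsub>H\<^esub>p\<in>?K. [Poly_Mapping.lookup u p] \<cdot>\<^bsub>H\<^esub> \<beta> (fst p) (snd p))"
    if "Poly_Mapping.keys u \<subseteq> ?K" for u
    unfolding frag_eval_def
    using that s t H.add.int_pow_closed[OF \<beta>]
    by (intro H.add.finprod_mono_neutral_cong_left) (auto intro!: \<beta> simp: zp not_in_keys_iff_lookup_eq_zero)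
  have K: "Poly_Mapping.keys (s + t) \<subseteq> ?K"
    by (rule keys_add)
  have cl: "\<beta> (fst p) (snd p) \<in> carrier H" if "p \<in> ?K" for p
    using that s t by (intro \<beta>) auto
  have pow_add: "[(m + n)] \<cdot>\<^bsub>H\<^esub> a = [m] \<cdot>\<^bsub>H\<^esub> a \<oplus>\<^bsub>H\<^esub> [n] \<cdot>\<^bsub>H\<^esub> a"
    if "a \<in> carrier H" for m n :: int and a
    using that group.int_pow_mult[OF H.a_group, of a m n] by (simp add: add_pow_def)
  have "frag_eval H \<beta> (s + t) =
      (\<Oplus>\<^bsub>H\<^esub>p\<in>?K. [Poly_Mapping.lookup s p] \<cdot>\<^bsub>H\<^esub> \<beta> (fst p) (snd p)
        \<oplus>\<^bsub>H\<^esub> [Poly_Mapping.lookup t p] \<cdot>\<^bsub>H\<^esub> \<beta> (fst p) (snd p))"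
    unfolding *[OF K]
    by (intro H.add.finprod_cong') (use cl in \<open>auto simp: lookup_add pow_add intro!: H.add.int_pow_closed\<close>)
  also have "\<dots> = frag_eval H \<beta> s \<oplus>\<^bsub>H\<^esub> frag_eval H \<beta> t"
    unfolding *[OF Un_upper1] *[OF Un_upper2]
    by (intro H.add.finprod_multf) (auto intro!: H.add.int_pow_closed cl)
  finally show ?thesis .
qed

lemma frag_eval_of:
  assumes "abelian_group H" "\<beta> x y \<in> carrier H"
  shows "frag_eval H \<beta> (frag_of (x, y)) = \<beta> x y"
proof -
  interpret H: abelian_group H by fact
  show ?thesis
    using assms(2) by (simp add: frag_eval_def)
qed

lemma frag_eval_zero: "abelian_group H \<Longrightarrow> frag_eval H \<beta> 0 = \<zero>\<^bsub>H\<^esub>"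
proof -
  assume "abelian_group H"
  then interpret H: abelian_group H .
  show ?thesis by (simp add: frag_eval_def)
qed

lemma frag_eval_closed:
  assumes H: "abelian_group H"
    and \<beta>: "\<And>x y. (x, y) \<in> S \<Longrightarrow> \<beta> x y \<in> carrier H"
    and t: "Poly_Mapping.keys t \<subseteq> S"
  shows "frag_eval H \<beta> t \<in> carrier H"
proof -
  interpret H: abelian_group H by fact
  show ?thesis
    unfolding frag_eval_def using t \<beta> by (intro H.finsum_closed) auto
qed

lemma frag_eval_diff:
  assumes H: "abelian_group H"
    and \<beta>: "\<And>x y. (x, y) \<in> S \<Longrightarrow> \<beta> x y \<in> carrier H"
    and s: "Poly_Mapping.keys s \<subseteq> S" and t: "Poly_Mapping.keys t \<subseteq> S"
  shows "frag_eval H \<beta> (s - t) = frag_eval H \<beta> s \<ominus>\<^bsub>H\<^esub> frag_eval H \<beta> t"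
proof -
  interpret H: abelian_group H by fact
  have k: "Poly_Mapping.keys (s - t) \<subseteq> S"
    using s t keys_diff by (metis Un_least order_trans)
  have "frag_eval H \<beta> s = frag_eval H \<beta> (s - t) \<oplus>\<^bsub>H\<^esub> frag_eval H \<beta> t"
    using frag_eval_add[OF H \<beta> k t] by simp
  then show ?thesis
    using frag_eval_closed[OF H \<beta> k] frag_eval_closed[OF H \<beta> t]
    by (simp add: H.minus_eq H.add.inv_solve_right)
qed

text \<open>Closure of both actions is what places the relators in the free abelian group on the pairs.\<close>

locale tensor_pair = X: abelian_group X + Y: abelian_group Y
  for R :: "('r, 'c) ring_scheme" and X :: "('x, 'd) ring_scheme" and ra :: "'x \<Rightarrow> 'r \<Rightarrow> 'x"
    and Y :: "('r, 'y, 'e) module_scheme" +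
  assumes ra_closed: "\<lbrakk>x \<in> carrier X; r \<in> carrier R\<rbrakk> \<Longrightarrow> ra x r \<in> carrier X"
    and la_closed: "\<lbrakk>r \<in> carrier R; y \<in> carrier Y\<rbrakk> \<Longrightarrow> r \<odot>\<^bsub>Y\<^esub> y \<in> carrier Y"
begin

abbreviation "pairs \<equiv> carrier X \<times> carrier Y"
abbreviation "free \<equiv> free_Abelian_group pairs"
abbreviation "T \<equiv> tensor R X ra Y"
abbreviation pure (infixl "\<otimes>\<otimes>" 71) where "x \<otimes>\<otimes> y \<equiv> pure_tensor R X ra Y x y"
abbreviation "N \<equiv> tensor_subgroup R X ra Y"

lemma free_add: "\<lbrakk>s \<in> carrier free; t \<in> carrier free\<rbrakk> \<Longrightarrow> s + t \<in> carrier free"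
  using keys_add[of s t] by auto

lemma free_diff: "\<lbrakk>s \<in> carrier free; t \<in> carrier free\<rbrakk> \<Longrightarrow> s - t \<in> carrier free"
  using keys_diff[of s t] by auto

lemma relators_free: "tensor_relators R X ra Y \<subseteq> carrier free"
  unfolding tensor_relators_def
  by (intro Un_least subsetI; elim CollectE exE conjE; hypsubst; intro free_diff)
    (simp_all add: ra_closed la_closed)

lemma subgroup_N: "subgroup N free"
  unfolding tensor_subgroup_def
  by (rule group.generate_is_subgroup[OF group_free_Abelian_group relators_free])

lemma normal_N: "N \<lhd> free"
  using abelian_free_Abelian_group comm_group.normal_iff_subgroup subgroup_N by blast

lemma tensor_abelian_group: "abelian_group T"
proof (rule comm_group_abelian_groupI)
  have "comm_group (free Mod N)"
    by (rule comm_group.abelian_FactGroup[OF abelian_free_Abelian_group subgroup_N])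
  moreover have "add_monoid T = free Mod N"
    by (simp add: tensor_def tensor_quot_def)
  ultimately show "comm_group (add_monoid T)"
    by simp
qed

lemma carrier_T: "carrier T = (\<lambda>t. N #>\<^bsub>free\<^esub> t) ` carrier free"
  by (simp add: tensor_def tensor_quot_def carrier_FactGroup)

lemma class_add:
  assumes "s \<in> carrier free" "t \<in> carrier free"
  shows "(N #>\<^bsub>free\<^esub> s) \<oplus>\<^bsub>T\<^esub> (N #>\<^bsub>free\<^esub> t) = N #>\<^bsub>free\<^esub> (s + t)"
  using normal.rcos_sum[OF normal_N assms] by (simp add: tensor_def tensor_quot_def)

lemma class_eqI:
  assumes "s \<in> carrier free" "t \<in> carrier free" "s - t \<in> N"
  shows "N #>\<^bsub>free\<^esub> s = N #>\<^bsub>free\<^esub> t"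
proof -
  have "s \<in> N #>\<^bsub>free\<^esub> t"
    unfolding r_coset_def using assms(3) by (force intro: bexI[of _ "s - t"])
  then show ?thesis
    using group.repr_independence[OF group_free_Abelian_group _ _ subgroup_N] assms(2) by metis
qed

lemma pure_closed: "\<lbrakk>x \<in> carrier X; y \<in> carrier Y\<rbrakk> \<Longrightarrow> x \<otimes>\<otimes> y \<in> carrier T"
  by (auto simp: carrier_T pure_tensor_def)

lemma relators_N: "t \<in> tensor_relators R X ra Y \<Longrightarrow> t \<in> N"
  by (simp add: tensor_subgroup_def generate.incl)

lemma pure_add_left:
  assumes "x \<in> carrier X" "x' \<in> carrier X" "y \<in> carrier Y"
  shows "(x \<oplus>\<^bsub>X\<^esub> x') \<otimes>\<otimes> y = x \<otimes>\<otimes> y \<oplus>\<^bsub>T\<^esub> x' \<otimes>\<otimes> y"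
proof -
  let ?a = "frag_of (x \<oplus>\<^bsub>X\<^esub> x', y)" and ?b = "frag_of (x, y)" and ?c = "frag_of (x', y)"
  have "?a - ?b - ?c \<in> tensor_relators R X ra Y"
    unfolding tensor_relators_def using assms by blast
  then have N: "?a - (?b + ?c) \<in> N"
    using relators_N by (simp add: diff_diff_eq)
  have c: "?a \<in> carrier free" "?b \<in> carrier free" "?c \<in> carrier free"
    using assms by auto
  show ?thesis
    unfolding pure_tensor_def class_add[OF c(2,3)]
    by (rule class_eqI[OF c(1) free_add[OF c(2,3)] N])
qed

lemma pure_add_right:
  assumes "x \<in> carrier X" "y \<in> carrier Y" "y' \<in> carrier Y"
  shows "x \<otimes>\<otimes> (y \<oplus>\<^bsub>Y\<^esub> y') = x \<otimes>\<otimes> y \<oplus>\<^bsub>T\<^esub> x \<otimes>\<otimes> y'"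
proof -
  let ?a = "frag_of (x, y \<oplus>\<^bsub>Y\<^esub> y')" and ?b = "frag_of (x, y)" and ?c = "frag_of (x, y')"
  have "?a - ?b - ?c \<in> tensor_relators R X ra Y"
    unfolding tensor_relators_def using assms by blast
  then have N: "?a - (?b + ?c) \<in> N"
    using relators_N by (simp add: diff_diff_eq)
  have c: "?a \<in> carrier free" "?b \<in> carrier free" "?c \<in> carrier free"
    using assms by auto
  show ?thesis
    unfolding pure_tensor_def class_add[OF c(2,3)]
    by (rule class_eqI[OF c(1) free_add[OF c(2,3)] N])
qed

lemma pure_swap:
  assumes "x \<in> carrier X" "r \<in> carrier R" "y \<in> carrier Y"
  shows "ra x r \<otimes>\<otimes> y = x \<otimes>\<otimes> (r \<odot>\<^bsub>Y\<^esub> y)"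
proof -
  have "frag_of (ra x r, y) - frag_of (x, r \<odot>\<^bsub>Y\<^esub> y) \<in> tensor_relators R X ra Y"
    unfolding tensor_relators_def using assms by blast
  then show ?thesis
    unfolding pure_tensor_def
    using assms by (intro class_eqI relators_N) (auto simp: ra_closed la_closed)
qed

lemma pure_balanced: "balanced R X ra Y T (\<otimes>\<otimes>)"
  by (intro balancedI add_homI) (auto simp: pure_closed pure_add_left pure_add_right pure_swap)

text \<open>The free abelian group is generated by the pairs, hence the tensor product by the pure
  tensors. Equality of values is stable under differences because addition in \<open>H\<close> cancels.\<close>

lemma tensor_ext:
  assumes H: "abelian_group H" and g: "g \<in> add_hom T H" and h: "h \<in> add_hom T H"
    and eq: "\<And>x y. \<lbrakk>x \<in> carrier X; y \<in> carrier Y\<rbrakk> \<Longrightarrow> g (x \<otimes>\<otimes> y) = h (x \<otimes>\<otimes> y)"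
    and u: "u \<in> carrier T"
  shows "g u = h u"
proof -
  interpret H: abelian_group H by fact
  interpret T: abelian_group T by (rule tensor_abelian_group)
  let ?c = "\<lambda>t. N #>\<^bsub>free\<^esub> t"
  obtain t where t: "Poly_Mapping.keys t \<subseteq> pairs" and ut: "u = ?c t"
    using u by (auto simp: carrier_T)
  have zero: "?c 0 = \<zero>\<^bsub>T\<^esub>"
    using group.coset_mult_one[OF group_free_Abelian_group, of N pairs] subgroup.subset[OF subgroup_N]
    by (simp add: tensor_def tensor_quot_def)
  have "g (?c t) = h (?c t)"
  proof (rule free_Abelian_group_induct[OF t])
    show "g (?c 0) = h (?c 0)"
      unfolding zero by (simp add: add_hom_zero[OF tensor_abelian_group H g] add_hom_zero[OF tensor_abelian_group H h])
  next
    fix s t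
    assume st: "Poly_Mapping.keys s \<subseteq> pairs" "Poly_Mapping.keys t \<subseteq> pairs"
      and IH: "g (?c s) = h (?c s)" "g (?c t) = h (?c t)"
    then have k: "s - t \<in> carrier free"
      by (intro free_diff) auto
    have c: "?c (s - t) \<in> carrier T" "?c t \<in> carrier T" "?c s \<in> carrier T"
      using st k unfolding carrier_T by auto
    have e: "?c s = ?c (s - t) \<oplus>\<^bsub>T\<^esub> ?c t"
      using class_add[OF k, of t] st(2) by simp
    have "g (?c (s - t)) \<oplus>\<^bsub>H\<^esub> g (?c t) = h (?c (s - t)) \<oplus>\<^bsub>H\<^esub> h (?c t)"
      using IH(1) unfolding e add_hom_add[OF g c(1,2)] add_hom_add[OF h c(1,2)] .
    then show "g (?c (s - t)) = h (?c (s - t))"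
      unfolding IH(2) using c by (simp add: add_hom_closed[OF g] add_hom_closed[OF h])
  next
    fix a assume "a \<in> pairs"
    then show "g (?c (frag_of a)) = h (?c (frag_of a))"
      using eq[of "fst a" "snd a"] by (auto simp: pure_tensor_def)
  qed
  then show ?thesis
    by (simp add: ut)
qed

text \<open>Balancedness says exactly that the evaluation of \<open>\<beta>\<close> vanishes on each relator, which is why it
  descends to cosets of the subgroup that the relators generate.\<close>

lemma frag_eval_N:
  assumes H: "abelian_group H" and \<beta>: "balanced R X ra Y H \<beta>" and t: "t \<in> N"
  shows "frag_eval H \<beta> t = \<zero>\<^bsub>H\<^esub>"
proof -
  interpret H: abelian_group H by fact
  have cl: "\<beta> x y \<in> carrier H" if "(x, y) \<in> pairs" for x y
    using that balanced_closed[OF \<beta>] by auto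
  have sum: "frag_eval H \<beta> (frag_of p - frag_of q - frag_of q') = \<zero>\<^bsub>H\<^esub>"
    if "p \<in> pairs" "q \<in> pairs" "q' \<in> pairs"
      and "\<beta> (fst p) (snd p) = \<beta> (fst q) (snd q) \<oplus>\<^bsub>H\<^esub> \<beta> (fst q') (snd q')" for p q q'
  proof -
    have *: "Poly_Mapping.keys (frag_of q + frag_of q') \<subseteq> pairs"
      using free_add[of "frag_of q" "frag_of q'"] that by simp
    have of: "frag_eval H \<beta> (frag_of a) = \<beta> (fst a) (snd a)" if "a \<in> pairs" for a
      using that cl frag_eval_of[OF H, of \<beta> "fst a" "snd a"] by (cases a) simp
    have "frag_eval H \<beta> (frag_of p - (frag_of q + frag_of q'))
        = frag_eval H \<beta> (frag_of p) \<ominus>\<^bsub>H\<^esub> frag_eval H \<beta> (frag_of q + frag_of q')"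
      using that(1) by (intro frag_eval_diff[OF H cl _ *]) auto
    also have "\<dots> = \<beta> (fst p) (snd p) \<ominus>\<^bsub>H\<^esub> \<beta> (fst p) (snd p)"
      using that frag_eval_add[of H pairs \<beta> "frag_of q" "frag_of q'", OF H cl] by (simp add: of)
    also have "\<dots> = \<zero>\<^bsub>H\<^esub>"
      using that(1) cl[of "fst p" "snd p"] by (simp add: H.minus_eq H.r_neg)
    finally show ?thesis
      by (simp add: diff_diff_eq)
  qed
  have rel: "frag_eval H \<beta> r = \<zero>\<^bsub>H\<^esub>" if "r \<in> tensor_relators R X ra Y" for r
    using that unfolding tensor_relators_def
  proof (elim UnE CollectE exE conjE)
    fix x x' y assume r: "r = frag_of (x \<oplus>\<^bsub>X\<^esub> x', y) - frag_of (x, y) - frag_of (x', y)"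
      and "x \<in> carrier X" "x' \<in> carrier X" "y \<in> carrier Y"
    then show ?thesis
      unfolding r using add_hom_add[OF balanced_left[OF \<beta>], of y x x']
      by (intro sum) auto
  next
    fix x y y' assume r: "r = frag_of (x, y \<oplus>\<^bsub>Y\<^esub> y') - frag_of (x, y) - frag_of (x, y')"
      and "x \<in> carrier X" "y \<in> carrier Y" "y' \<in> carrier Y"
    then show ?thesis
      unfolding r using add_hom_add[OF balanced_right[OF \<beta>], of x y y']
      by (intro sum) auto
  next
    fix x s y assume r: "r = frag_of (ra x s, y) - frag_of (x, s \<odot>\<^bsub>Y\<^esub> y)"
      and *: "x \<in> carrier X" "s \<in> carrier R" "y \<in> carrier Y"
    then have p: "(ra x s, y) \<in> pairs" "(x, s \<odot>\<^bsub>Y\<^esub> y) \<in> pairs"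
      by (auto simp: ra_closed la_closed)
    have "frag_eval H \<beta> r = \<beta> (ra x s) y \<ominus>\<^bsub>H\<^esub> \<beta> x (s \<odot>\<^bsub>Y\<^esub> y)"
      unfolding r using p by (subst frag_eval_diff[of H pairs \<beta>, OF H cl]) (auto simp: frag_eval_of[OF H] cl)
    then show ?thesis
      unfolding balanced_swap[OF \<beta> *] using cl[OF p(2)] by (simp add: H.minus_eq H.r_neg)
  qed
  have keys_rel: "Poly_Mapping.keys r \<subseteq> pairs" if "r \<in> tensor_relators R X ra Y" for r
    using that relators_free by (meson carrier_free_Abelian_group_iff subsetD)
  have "Poly_Mapping.keys t \<subseteq> pairs \<and> ?thesis"
    using t unfolding tensor_subgroup_def
  proof (induction rule: generate.induct)
    case one
    then show ?case by (simp add: frag_eval_zero[OF H])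
  next
    case (incl r)
    then show ?case using rel keys_rel by blast
  next
    case (inv r)
    then show ?case
      using frag_eval_diff[of H pairs \<beta> 0 r, OF H cl] rel[OF inv] keys_rel[OF inv]
      by (simp add: frag_eval_zero[OF H] H.minus_eq)
  next
    case (eng s t)
    then show ?case
      using free_add[of s t] frag_eval_add[of H pairs \<beta> s t, OF H cl] by simp
  qed
  then show ?thesis ..
qed

lemma lift_class:
  assumes H: "abelian_group H" and \<beta>: "balanced R X ra Y H \<beta>" and t: "Poly_Mapping.keys t \<subseteq> pairs"
  shows "tensor_lift H \<beta> (N #>\<^bsub>free\<^esub> t) = frag_eval H \<beta> t"
proof -
  interpret H: abelian_group H by fact
  have cl: "\<beta> x y \<in> carrier H" if "(x, y) \<in> pairs" for x y
    using that balanced_closed[OF \<beta>] by auto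
  have N: "Poly_Mapping.keys s \<subseteq> pairs" if "s \<in> N" for s
    using subgroup.subset[OF subgroup_N] that by (meson carrier_free_Abelian_group_iff subsetD)
  have "frag_eval H \<beta> (s + t) = frag_eval H \<beta> t" if "s \<in> N" for s
    using frag_eval_add[OF H cl N[OF that] t] frag_eval_N[OF H \<beta> that] frag_eval_closed[OF H cl t]
    by simp
  moreover have "0 \<in> N"
    using subgroup.one_closed[OF subgroup_N] by simp
  ultimately have "frag_eval H \<beta> ` (N #>\<^bsub>free\<^esub> t) = {frag_eval H \<beta> t}"
    unfolding r_coset_def by auto
  then show ?thesis
    by (simp add: tensor_lift_def)
qed

lemma lift_pure:
  assumes "abelian_group H" "balanced R X ra Y H \<beta>" "x \<in> carrier X" "y \<in> carrier Y"
  shows "tensor_lift H \<beta> (x \<otimes>\<otimes> y) = \<beta> x y"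
  using assms by (simp add: pure_tensor_def lift_class frag_eval_of balanced_closed)

lemma lift_hom:
  assumes H: "abelian_group H" and \<beta>: "balanced R X ra Y H \<beta>"
  shows "tensor_lift H \<beta> \<in> add_hom T H"
proof (rule add_homI)
  have cl: "\<beta> x y \<in> carrier H" if "(x, y) \<in> pairs" for x y
    using that balanced_closed[OF \<beta>] by auto
  fix u assume "u \<in> carrier T"
  then obtain s where s: "Poly_Mapping.keys s \<subseteq> pairs" "u = N #>\<^bsub>free\<^esub> s"
    by (auto simp: carrier_T)
  then show "tensor_lift H \<beta> u \<in> carrier H"
    using frag_eval_closed[of H pairs \<beta>, OF H cl] by (simp add: lift_class[OF H \<beta>])
  fix v assume "v \<in> carrier T"
  then obtain t where t: "Poly_Mapping.keys t \<subseteq> pairs" "v = N #>\<^bsub>free\<^esub> t"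
    by (auto simp: carrier_T)
  then show "tensor_lift H \<beta> (u \<oplus>\<^bsub>T\<^esub> v) = tensor_lift H \<beta> u \<oplus>\<^bsub>H\<^esub> tensor_lift H \<beta> v"
    using s free_add[of s t] frag_eval_add[of H pairs \<beta> s t, OF H cl]
    by (simp add: class_add lift_class[OF H \<beta>])
qed

text \<open>A lift depends additively on its balanced map. This is how an iterated Sweedler expression is
  seen to be balanced in its outer variables.\<close>

lemma lift_add_hom_param:
  assumes H: "abelian_group H" and P: "abelian_group P"
    and \<beta>: "\<And>p. p \<in> carrier P \<Longrightarrow> balanced R X ra Y H (\<beta> p)"
    and add: "\<And>x y. \<lbrakk>x \<in> carrier X; y \<in> carrier Y\<rbrakk> \<Longrightarrow> (\<lambda>p. \<beta> p x y) \<in> add_hom P H"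
    and u: "u \<in> carrier T"
  shows "(\<lambda>p. tensor_lift H (\<beta> p) u) \<in> add_hom P H"
proof (rule add_homI)
  interpret P: abelian_group P by fact
  fix p assume p: "p \<in> carrier P"
  show "tensor_lift H (\<beta> p) u \<in> carrier H"
    by (rule add_hom_closed[OF lift_hom[OF H \<beta>[OF p]] u])
  fix q assume q: "q \<in> carrier P"
  note pq = P.add.m_closed[OF p q]
  show "tensor_lift H (\<beta> (p \<oplus>\<^bsub>P\<^esub> q)) u = tensor_lift H (\<beta> p) u \<oplus>\<^bsub>H\<^esub> tensor_lift H (\<beta> q) u"
  proof (rule tensor_ext[OF H _ _ _ u])
    show "tensor_lift H (\<beta> (p \<oplus>\<^bsub>P\<^esub> q)) \<in> add_hom T H"
      by (rule lift_hom[OF H \<beta>[OF pq]])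
    show "(\<lambda>u. tensor_lift H (\<beta> p) u \<oplus>\<^bsub>H\<^esub> tensor_lift H (\<beta> q) u) \<in> add_hom T H"
      by (intro add_hom_plus H lift_hom \<beta> p q)
  qed (simp add: lift_pure[OF H] \<beta> p q pq add_hom_add[OF add])
qed

end

text \<open>A map of four variables that is balanced in the first pair and in the second pair induces a
  biadditive map on the two tensor products. Both the multiplication of \<open>E \<otimes> B\<close> and the action of
  \<open>E \<otimes> B\<close> on \<open>N \<otimes> Q\<close> are of this form.\<close>

lemma lift_lift:
  assumes T1: "tensor_pair R1 X1 ra1 Y1" and T2: "tensor_pair R2 X2 ra2 Y2" and H: "abelian_group H"
    and inner: "\<And>x1 y1. \<lbrakk>x1 \<in> carrier X1; y1 \<in> carrier Y1\<rbrakk> \<Longrightarrow> balanced R2 X2 ra2 Y2 H (\<gamma> x1 y1)"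
    and outer: "\<And>x2 y2. \<lbrakk>x2 \<in> carrier X2; y2 \<in> carrier Y2\<rbrakk>
      \<Longrightarrow> balanced R1 X1 ra1 Y1 H (\<lambda>x1 y1. \<gamma> x1 y1 x2 y2)"
  defines "D u v \<equiv> tensor_lift H (\<lambda>x1 y1. tensor_lift H (\<gamma> x1 y1) v) u"
  shows lift_lift_left: "v \<in> carrier (tensor R2 X2 ra2 Y2) \<Longrightarrow> (\<lambda>u. D u v) \<in> add_hom (tensor R1 X1 ra1 Y1) H"
    and lift_lift_right: "u \<in> carrier (tensor R1 X1 ra1 Y1) \<Longrightarrow> D u \<in> add_hom (tensor R2 X2 ra2 Y2) H"
    and lift_lift_pure: "\<lbrakk>x1 \<in> carrier X1; y1 \<in> carrier Y1; v \<in> carrier (tensor R2 X2 ra2 Y2)\<rbrakk> \<Longrightarrow>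
      D (pure_tensor R1 X1 ra1 Y1 x1 y1) v = tensor_lift H (\<gamma> x1 y1) v"
proof -
  interpret T1: tensor_pair R1 X1 ra1 Y1 by fact
  interpret T2: tensor_pair R2 X2 ra2 Y2 by fact
  have bal: "balanced R1 X1 ra1 Y1 H (\<lambda>x1 y1. tensor_lift H (\<gamma> x1 y1) v)" if v: "v \<in> carrier T2.T" for v
  proof (rule balancedI)
    fix x assume x: "x \<in> carrier X1"
    show "(\<lambda>y. tensor_lift H (\<gamma> x y) v) \<in> add_hom Y1 H"
      by (rule T2.lift_add_hom_param[OF H T1.Y.abelian_group_axioms inner[OF x] balanced_right[OF outer x] v])
  next
    fix y assume y: "y \<in> carrier Y1"
    show "(\<lambda>x. tensor_lift H (\<gamma> x y) v) \<in> add_hom X1 H"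
      by (rule T2.lift_add_hom_param[OF H T1.X.abelian_group_axioms inner[OF _ y] balanced_left[OF outer y] v])
  next
    fix x r y assume *: "x \<in> carrier X1" "r \<in> carrier R1" "y \<in> carrier Y1"
    then have b: "balanced R2 X2 ra2 Y2 H (\<gamma> (ra1 x r) y)" "balanced R2 X2 ra2 Y2 H (\<gamma> x (r \<odot>\<^bsub>Y1\<^esub> y))"
      by (auto intro!: inner T1.ra_closed T1.la_closed)
    show "tensor_lift H (\<gamma> (ra1 x r) y) v = tensor_lift H (\<gamma> x (r \<odot>\<^bsub>Y1\<^esub> y)) v"
      by (rule T2.tensor_ext[OF H T2.lift_hom[OF H b(1)] T2.lift_hom[OF H b(2)] _ v])
        (use * balanced_swap[OF outer *] in \<open>simp add: T2.lift_pure[OF H b(1)] T2.lift_pure[OF H b(2)]\<close>)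
  qed
  show "(\<lambda>u. D u v) \<in> add_hom T1.T H" if "v \<in> carrier T2.T"
    unfolding D_def by (rule T1.lift_hom[OF H bal[OF that]])
  show "D u \<in> add_hom T2.T H" if "u \<in> carrier T1.T"
    unfolding D_def
    by (rule T1.lift_add_hom_param[OF H T2.tensor_abelian_group bal T2.lift_hom[OF H inner] that])
  show "D (T1.pure x1 y1) v = tensor_lift H (\<gamma> x1 y1) v"
    if "x1 \<in> carrier X1" "y1 \<in> carrier Y1" "v \<in> carrier T2.T"
    unfolding D_def by (rule T1.lift_pure[OF H bal[OF that(3)] that(1,2)])
qed

section \<open>Semilinear maps\<close>

definition semilinear ::
    "('r, 'c) ring_scheme \<Rightarrow> ('r \<Rightarrow> 's) \<Rightarrow> ('r, 'm, 'd) module_scheme \<Rightarrow> ('s, 'n, 'e) module_scheme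
      \<Rightarrow> ('m \<Rightarrow> 'n) set" where
  "semilinear R g M N = {h \<in> add_hom M N. \<forall>r\<in>carrier R. \<forall>x\<in>carrier M. h (r \<odot>\<^bsub>M\<^esub> x) = g r \<odot>\<^bsub>N\<^esub> h x}"

abbreviation "linear R \<equiv> semilinear R (\<lambda>r. r)"

lemma semilinearI:
  assumes "h \<in> add_hom M N"
    and "\<And>r x. \<lbrakk>r \<in> carrier R; x \<in> carrier M\<rbrakk> \<Longrightarrow> h (r \<odot>\<^bsub>M\<^esub> x) = g r \<odot>\<^bsub>N\<^esub> h x"
  shows "h \<in> semilinear R g M N"
  using assms by (auto simp: semilinear_def)

lemma semilinear_add_hom: "h \<in> semilinear R g M N \<Longrightarrow> h \<in> add_hom M N"
  by (simp add: semilinear_def)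

lemma semilinear_smult:
  "\<lbrakk>h \<in> semilinear R g M N; r \<in> carrier R; x \<in> carrier M\<rbrakk> \<Longrightarrow> h (r \<odot>\<^bsub>M\<^esub> x) = g r \<odot>\<^bsub>N\<^esub> h x"
  by (simp add: semilinear_def)

lemmas semilinear_closed = add_hom_closed[OF semilinear_add_hom]

lemma lmod_hom_iff:
  "h \<in> lmod_hom R M N \<longleftrightarrow> h \<in> linear R M N \<and> h \<in> extensional (carrier M)"
  by (auto simp: lmod_hom_def semilinear_def add_hom_def PiE_def)

lemma restrict_lmod_hom:
  assumes "abelian_group M" "\<And>r x. \<lbrakk>r \<in> carrier R; x \<in> carrier M\<rbrakk> \<Longrightarrow> r \<odot>\<^bsub>M\<^esub> x \<in> carrier M"
    and "h \<in> linear R M N"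
  shows "restrict h (carrier M) \<in> lmod_hom R M N"
proof -
  interpret M: abelian_group M by fact
  show ?thesis
    using assms(2,3) by (auto simp: lmod_hom_iff semilinear_def add_hom_def)
qed

section \<open>Tensor products over a commutative ring\<close>

text \<open>A common interface to algebras and to the modules underlying modules over an algebra, so that
  \<open>E \<otimes> B\<close> and \<open>N \<otimes> Q\<close> are handled by the same lemmas.\<close>

locale kspace = abelian_group X
  for k :: "('k, 'c) ring_scheme" and X :: "('k, 'x, 'd) module_scheme" (structure) +
  assumes kspace_smult_closed: "\<lbrakk>c \<in> carrier k; x \<in> carrier X\<rbrakk> \<Longrightarrow> c \<odot>\<^bsub>X\<^esub> x \<in> carrier X"

lemma kspace_tensor_pair:
  assumes "kspace k X" "kspace k Y"
  shows "tensor_pair k X (\<lambda>x c. c \<odot>\<^bsub>X\<^esub> x) Y"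
  using assms by (simp add: tensor_pair_def tensor_pair_axioms_def kspace_def kspace_axioms_def)

lemmas kgroup_facts =
  tensor_pair.tensor_abelian_group[OF kspace_tensor_pair, folded kgroup_def kpure_def]
  tensor_pair.pure_closed[OF kspace_tensor_pair, folded kgroup_def kpure_def]
  tensor_pair.pure_balanced[OF kspace_tensor_pair, folded kgroup_def kpure_def]
  tensor_pair.tensor_ext[OF kspace_tensor_pair, folded kgroup_def kpure_def]
  tensor_pair.lift_hom[OF kspace_tensor_pair, folded kgroup_def kpure_def]
  tensor_pair.lift_pure[OF kspace_tensor_pair, folded kgroup_def kpure_def]

lemmas kgroup_abelian_group = kgroup_facts(1)
  and kpure_closed = kgroup_facts(2)
  and kpure_balanced = kgroup_facts(3)
  and kgroup_ext = kgroup_facts(4)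
  and klift_hom = kgroup_facts(5)
  and klift_pure = kgroup_facts(6)

lemma tensor_map_balanced:
  assumes "kspace k X'" "kspace k Y'" and g: "g \<in> linear k X X'" and h: "h \<in> linear k Y Y'"
  shows "balanced k X (\<lambda>x c. c \<odot>\<^bsub>X\<^esub> x) Y (kgroup k X' Y') (\<lambda>x y. kpure k X' Y' (g x) (h y))"
proof (rule balancedI)
  note b = kpure_balanced[OF assms(1,2)]
  show "(\<lambda>y. kpure k X' Y' (g x) (h y)) \<in> add_hom Y (kgroup k X' Y')" if "x \<in> carrier X" for x
    by (rule add_hom_comp[OF semilinear_add_hom[OF h] balanced_right[OF b semilinear_closed[OF g that]]])
  show "(\<lambda>x. kpure k X' Y' (g x) (h y)) \<in> add_hom X (kgroup k X' Y')" if "y \<in> carrier Y" for y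
    by (rule add_hom_comp[OF semilinear_add_hom[OF g] balanced_left[OF b semilinear_closed[OF h that]]])
  show "kpure k X' Y' (g (c \<odot>\<^bsub>X\<^esub> x)) (h y) = kpure k X' Y' (g x) (h (c \<odot>\<^bsub>Y\<^esub> y))"
    if "x \<in> carrier X" "c \<in> carrier k" "y \<in> carrier Y" for x c y
    using balanced_swap[OF b semilinear_closed[OF g that(1)] that(2) semilinear_closed[OF h that(3)]] that
    by (simp add: semilinear_smult[OF g] semilinear_smult[OF h])
qed

definition bilinear ::
    "('k, 'c) ring_scheme \<Rightarrow> ('k, 'x, 'd) module_scheme \<Rightarrow> ('k, 'y, 'e) module_scheme
      \<Rightarrow> ('k, 'z, 'f) module_scheme \<Rightarrow> ('x \<Rightarrow> 'y \<Rightarrow> 'z) set" where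
  "bilinear k X Y Z = {\<mu>. (\<forall>x\<in>carrier X. \<mu> x \<in> linear k Y Z) \<and> (\<forall>y\<in>carrier Y. (\<lambda>x. \<mu> x y) \<in> linear k X Z)}"

text \<open>The map \<open>(x\<^sub>1 \<otimes> y\<^sub>1, x\<^sub>2 \<otimes> y\<^sub>2) \<mapsto> \<mu>(x\<^sub>1, x\<^sub>2) \<otimes> \<nu>(y\<^sub>1, y\<^sub>2)\<close>. Treating the product of \<open>E \<otimes> B\<close> and
  its action on \<open>N \<otimes> Q\<close> as instances of one construction lets a single lemma cover both.\<close>

definition tensor_bilinear ::
    "('k, 'c) ring_scheme \<Rightarrow> ('k, 'x, 'd) module_scheme \<Rightarrow> ('k, 'y, 'e) module_scheme
      \<Rightarrow> ('x1 \<Rightarrow> 'x2 \<Rightarrow> 'x) \<Rightarrow> ('y1 \<Rightarrow> 'y2 \<Rightarrow> 'y) \<Rightarrow> ('x1, 'y1) tens \<Rightarrow> ('x2, 'y2) tens \<Rightarrow> ('x, 'y) tens" where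
  "tensor_bilinear k X Y \<mu> \<nu> u v =
     tensor_lift (kgroup k X Y) (\<lambda>x1 y1. tensor_lift (kgroup k X Y)
       (\<lambda>x2 y2. kpure k X Y (\<mu> x1 x2) (\<nu> y1 y2)) v) u"

lemma tensor_bilinear:
  assumes sp: "kspace k X1" "kspace k Y1" "kspace k X2" "kspace k Y2" "kspace k X" "kspace k Y"
    and \<mu>: "\<mu> \<in> bilinear k X1 X2 X" and \<nu>: "\<nu> \<in> bilinear k Y1 Y2 Y"
  shows tensor_bilinear_left: "v \<in> carrier (kgroup k X2 Y2)
      \<Longrightarrow> (\<lambda>u. tensor_bilinear k X Y \<mu> \<nu> u v) \<in> add_hom (kgroup k X1 Y1) (kgroup k X Y)"
    and tensor_bilinear_right: "u \<in> carrier (kgroup k X1 Y1)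
      \<Longrightarrow> tensor_bilinear k X Y \<mu> \<nu> u \<in> add_hom (kgroup k X2 Y2) (kgroup k X Y)"
    and tensor_bilinear_pure: "\<lbrakk>x1 \<in> carrier X1; y1 \<in> carrier Y1; x2 \<in> carrier X2; y2 \<in> carrier Y2\<rbrakk>
      \<Longrightarrow> tensor_bilinear k X Y \<mu> \<nu> (kpure k X1 Y1 x1 y1) (kpure k X2 Y2 x2 y2)
        = kpure k X Y (\<mu> x1 x2) (\<nu> y1 y2)"
proof -
  have inner: "balanced k X2 (\<lambda>x c. c \<odot>\<^bsub>X2\<^esub> x) Y2 (kgroup k X Y) (\<lambda>x2 y2. kpure k X Y (\<mu> x1 x2) (\<nu> y1 y2))"
    if "x1 \<in> carrier X1" "y1 \<in> carrier Y1" for x1 y1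
    using that \<mu> \<nu> sp by (intro tensor_map_balanced) (auto simp: bilinear_def)
  have outer: "balanced k X1 (\<lambda>x c. c \<odot>\<^bsub>X1\<^esub> x) Y1 (kgroup k X Y) (\<lambda>x1 y1. kpure k X Y (\<mu> x1 x2) (\<nu> y1 y2))"
    if "x2 \<in> carrier X2" "y2 \<in> carrier Y2" for x2 y2
    using that \<mu> \<nu> sp by (intro tensor_map_balanced) (auto simp: bilinear_def)
  note H = kgroup_abelian_group[OF sp(5,6)]
  note L = lift_lift[OF kspace_tensor_pair[OF sp(1,2)] kspace_tensor_pair[OF sp(3,4)] H inner outer,
      folded kgroup_def kpure_def]
  show "(\<lambda>u. tensor_bilinear k X Y \<mu> \<nu> u v) \<in> add_hom (kgroup k X1 Y1) (kgroup k X Y)"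
    if "v \<in> carrier (kgroup k X2 Y2)"
    unfolding tensor_bilinear_def by (rule L(1)[OF _ _ _ _ that])
  show "tensor_bilinear k X Y \<mu> \<nu> u \<in> add_hom (kgroup k X2 Y2) (kgroup k X Y)"
    if "u \<in> carrier (kgroup k X1 Y1)"
    unfolding tensor_bilinear_def[abs_def] by (rule L(2)[OF _ _ _ _ that])
  show "tensor_bilinear k X Y \<mu> \<nu> (kpure k X1 Y1 x1 y1) (kpure k X2 Y2 x2 y2)
        = kpure k X Y (\<mu> x1 x2) (\<nu> y1 y2)"
    if *: "x1 \<in> carrier X1" "y1 \<in> carrier Y1" "x2 \<in> carrier X2" "y2 \<in> carrier Y2"
    unfolding tensor_bilinear_def
    using L(3)[OF _ _ _ _ *(1,2) kpure_closed[OF sp(3,4) *(3,4)]] klift_pure[OF sp(3,4) H inner[OF *(1,2)] *(3,4)]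
    by simp
qed

section \<open>Extension of scalars\<close>

lemma abelian_group_cong:
  assumes "abelian_group G"
    and "carrier G' = carrier G" "add G' = add G" "\<zero>\<^bsub>G'\<^esub> = \<zero>\<^bsub>G\<^esub>"
  shows "abelian_group G'"
  by (rule abelian_groupI) (use abelian_groupE[OF assms(1)] assms(2-4) in auto)

lemma left_module_smult_right:
  assumes "left_module A M" "a \<in> carrier A"
  shows "(\<odot>\<^bsub>M\<^esub>) a \<in> add_hom M M"
  using assms by (auto intro: add_homI left_module.lsmult_closed left_module.lsmult_r_distr)

lemma left_module_smult_left:
  assumes "left_module A M" "x \<in> carrier M"
  shows "(\<lambda>a. a \<odot>\<^bsub>M\<^esub> x) \<in> add_hom A M"
  using assms by (auto intro: add_homI left_module.lsmult_closed left_module.lsmult_l_distr)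

lemma ext_obj_simps [simp]:
  "carrier (ext_obj A A' g M) = carrier (ext_group A A' g M)"
  "add (ext_obj A A' g M) = add (ext_group A A' g M)"
  "\<zero>\<^bsub>ext_obj A A' g M\<^esub> = \<zero>\<^bsub>ext_group A A' g M\<^esub>"
  by (simp_all add: ext_obj_def ring.defs module.defs)

lemma ext_obj_smult:
  "(\<odot>\<^bsub>ext_obj A A' g M\<^esub>) a =
    tensor_lift (ext_group A A' g M) (\<lambda>x m. ext_pure A A' g M (a \<otimes>\<^bsub>A'\<^esub> x) m)"
  by (simp add: ext_obj_def ring.defs module.defs)

locale scalar_ext = A: ring A + A': ring A'
  for A :: "('a, 'c) ring_scheme" and A' :: "('b, 'd) ring_scheme" and g :: "'a \<Rightarrow> 'b" +
  assumes g: "g \<in> ring_hom A A'"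
begin

lemma g_closed: "a \<in> carrier A \<Longrightarrow> g a \<in> carrier A'"
  by (rule ring_hom_closed[OF g])

lemma ext_tensor_pair: "left_module A M \<Longrightarrow> tensor_pair A A' (\<lambda>x a. x \<otimes>\<^bsub>A'\<^esub> g a) M"
  by (auto simp: tensor_pair_def tensor_pair_axioms_def left_module_def left_module_axioms_def
      A'.abelian_group_axioms g_closed)

lemmas ext_facts =
  tensor_pair.tensor_abelian_group[OF ext_tensor_pair, folded ext_group_def ext_pure_def]
  tensor_pair.pure_closed[OF ext_tensor_pair, folded ext_group_def ext_pure_def]
  tensor_pair.pure_balanced[OF ext_tensor_pair, folded ext_group_def ext_pure_def]
  tensor_pair.tensor_ext[OF ext_tensor_pair, folded ext_group_def ext_pure_def]
  tensor_pair.lift_hom[OF ext_tensor_pair, folded ext_group_def ext_pure_def]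
  tensor_pair.lift_pure[OF ext_tensor_pair, folded ext_group_def ext_pure_def]
  tensor_pair.lift_add_hom_param[OF ext_tensor_pair, folded ext_group_def ext_pure_def]

lemmas ext_group_abelian_group = ext_facts(1)
  and ext_pure_closed = ext_facts(2)
  and ext_pure_balanced = ext_facts(3)
  and ext_group_ext = ext_facts(4)
  and ext_lift_hom = ext_facts(5)
  and ext_lift_pure = ext_facts(6)
  and ext_lift_param = ext_facts(7)

lemma ext_smult_balanced:
  assumes M: "left_module A M" and a: "a \<in> carrier A'"
  shows "balanced A A' (\<lambda>x a. x \<otimes>\<^bsub>A'\<^esub> g a) M (ext_group A A' g M) (\<lambda>x m. ext_pure A A' g M (a \<otimes>\<^bsub>A'\<^esub> x) m)"
proof (rule balancedI)
  note b = ext_pure_balanced[OF M]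
  show "ext_pure A A' g M (a \<otimes>\<^bsub>A'\<^esub> x) \<in> add_hom M (ext_group A A' g M)" if "x \<in> carrier A'" for x
    using balanced_right[OF b] a that by simp
  have "(\<otimes>\<^bsub>A'\<^esub>) a \<in> add_hom A' A'"
    using a by (auto intro: add_homI A'.r_distr)
  then show "(\<lambda>x. ext_pure A A' g M (a \<otimes>\<^bsub>A'\<^esub> x) m) \<in> add_hom A' (ext_group A A' g M)"
    if "m \<in> carrier M" for m
    by (rule add_hom_comp[OF _ balanced_left[OF b that]])
  show "ext_pure A A' g M (a \<otimes>\<^bsub>A'\<^esub> (x \<otimes>\<^bsub>A'\<^esub> g r)) m = ext_pure A A' g M (a \<otimes>\<^bsub>A'\<^esub> x) (r \<odot>\<^bsub>M\<^esub> m)"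
    if "x \<in> carrier A'" "r \<in> carrier A" "m \<in> carrier M" for x r m
    using balanced_swap[OF b _ that(2,3), of "a \<otimes>\<^bsub>A'\<^esub> x"] a that by (simp add: A'.m_assoc g_closed)
qed

lemma ext_smult_pure:
  assumes "left_module A M" "a \<in> carrier A'" "x \<in> carrier A'" "m \<in> carrier M"
  shows "a \<odot>\<^bsub>ext_obj A A' g M\<^esub> ext_pure A A' g M x m = ext_pure A A' g M (a \<otimes>\<^bsub>A'\<^esub> x) m"
  using assms by (simp add: ext_obj_smult ext_lift_pure ext_group_abelian_group ext_smult_balanced)

lemma left_module_ext_obj:
  assumes M: "left_module A M"
  shows "left_module A' (ext_obj A A' g M)"
proof -
  let ?G = "ext_group A A' g M" and ?P = "ext_obj A A' g M" and ?p = "ext_pure A A' g M"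
  note G = ext_group_abelian_group[OF M]
  interpret G: abelian_group ?G by (rule G)
  note pc = ext_pure_closed[OF M]
  have right: "(\<odot>\<^bsub>?P\<^esub>) a \<in> add_hom ?G ?G" if "a \<in> carrier A'" for a
    unfolding ext_obj_smult by (rule ext_lift_hom[OF M G ext_smult_balanced[OF M that]])
  have left: "(\<lambda>a. a \<odot>\<^bsub>?P\<^esub> u) \<in> add_hom A' ?G" if u: "u \<in> carrier ?G" for u
    unfolding ext_obj_smult
  proof (rule ext_lift_param[OF M G A'.abelian_group_axioms ext_smult_balanced[OF M] _ u])
    fix x m assume x: "x \<in> carrier A'" and m: "m \<in> carrier M"
    have "(\<lambda>a. a \<otimes>\<^bsub>A'\<^esub> x) \<in> add_hom A' A'"
      using x by (auto intro: add_homI A'.l_distr)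
    then show "(\<lambda>a. ?p (a \<otimes>\<^bsub>A'\<^esub> x) m) \<in> add_hom A' ?G"
      by (rule add_hom_comp[OF _ balanced_left[OF ext_pure_balanced[OF M] m]])
  qed
  note pure = ext_smult_pure[OF M]
  show ?thesis
  proof (intro left_module.intro left_module_axioms.intro)
    show "ring A'" by (rule A'.ring_axioms)
    show "abelian_group ?P" by (rule abelian_group_cong[OF G]) simp_all
  next
    fix a u assume "a \<in> carrier A'" "u \<in> carrier ?P"
    then show "a \<odot>\<^bsub>?P\<^esub> u \<in> carrier ?P"
      using add_hom_closed[OF right] by simp
  next
    fix a b u assume "a \<in> carrier A'" "b \<in> carrier A'" "u \<in> carrier ?P"
    then show "(a \<oplus>\<^bsub>A'\<^esub> b) \<odot>\<^bsub>?P\<^esub> u = a \<odot>\<^bsub>?P\<^esub> u \<oplus>\<^bsub>?P\<^esub> b \<odot>\<^bsub>?P\<^esub> u"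
      using add_hom_add[OF left] by simp
  next
    fix a u v assume "a \<in> carrier A'" "u \<in> carrier ?P" "v \<in> carrier ?P"
    then show "a \<odot>\<^bsub>?P\<^esub> (u \<oplus>\<^bsub>?P\<^esub> v) = a \<odot>\<^bsub>?P\<^esub> u \<oplus>\<^bsub>?P\<^esub> a \<odot>\<^bsub>?P\<^esub> v"
      using add_hom_add[OF right] by simp
  next
    fix a b u assume a: "a \<in> carrier A'" and b: "b \<in> carrier A'" and u: "u \<in> carrier ?P"
    show "(a \<otimes>\<^bsub>A'\<^esub> b) \<odot>\<^bsub>?P\<^esub> u = a \<odot>\<^bsub>?P\<^esub> (b \<odot>\<^bsub>?P\<^esub> u)"
    proof (rule ext_group_ext[OF M G right add_hom_comp[OF right right]])
      show "(a \<otimes>\<^bsub>A'\<^esub> b) \<odot>\<^bsub>?P\<^esub> ?p x m = a \<odot>\<^bsub>?P\<^esub> (b \<odot>\<^bsub>?P\<^esub> ?p x m)"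
        if "x \<in> carrier A'" "m \<in> carrier M" for x m
        using that a b by (simp add: pure A'.m_assoc)
    qed (use a b u in auto)
  next
    fix u assume u: "u \<in> carrier ?P"
    show "\<one>\<^bsub>A'\<^esub> \<odot>\<^bsub>?P\<^esub> u = u"
    proof (rule ext_group_ext[OF M G right])
      show "(\<lambda>u. u) \<in> add_hom ?G ?G" by (simp add: add_hom_def)
      show "\<one>\<^bsub>A'\<^esub> \<odot>\<^bsub>?P\<^esub> ?p x m = ?p x m" if "x \<in> carrier A'" "m \<in> carrier M" for x m
        using that by (simp add: pure)
    qed (use u in auto)
  qed
qed

lemma ext_unit_closed: "\<lbrakk>left_module A M; m \<in> carrier M\<rbrakk> \<Longrightarrow> ext_unit A A' g M m \<in> carrier (ext_group A A' g M)"
  by (simp add: ext_unit_def ext_pure_closed)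

lemma ext_pure_eq_smult_unit:
  assumes "left_module A M" "x \<in> carrier A'" "m \<in> carrier M"
  shows "ext_pure A A' g M x m = x \<odot>\<^bsub>ext_obj A A' g M\<^esub> ext_unit A A' g M m"
  using assms by (simp add: ext_unit_def ext_smult_pure)

lemma ext_unit_semilinear:
  assumes M: "left_module A M"
  shows "ext_unit A A' g M \<in> semilinear A g M (ext_obj A A' g M)"
proof (rule semilinearI)
  note b = ext_pure_balanced[OF M]
  show "ext_unit A A' g M \<in> add_hom M (ext_obj A A' g M)"
    using balanced_right[OF b A'.one_closed] by (simp add: ext_unit_def[abs_def] add_hom_def)
  show "ext_unit A A' g M (a \<odot>\<^bsub>M\<^esub> m) = g a \<odot>\<^bsub>ext_obj A A' g M\<^esub> ext_unit A A' g M m"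
    if "a \<in> carrier A" "m \<in> carrier M" for a m
    using balanced_swap[OF b A'.one_closed that] that M by (simp add: ext_unit_def ext_smult_pure g_closed)
qed

text \<open>Since \<open>x \<otimes> m = x \<cdot> (1 \<otimes> m)\<close>, the image of the unit generates \<open>g\<^sup>*M\<close> over \<open>A'\<close>.\<close>

lemma ext_obj_linear_ext:
  assumes M: "left_module A M" and P: "left_module A' P"
    and h: "h \<in> linear A' (ext_obj A A' g M) P" and h': "h' \<in> linear A' (ext_obj A A' g M) P"
    and eq: "\<And>m. m \<in> carrier M \<Longrightarrow> h (ext_unit A A' g M m) = h' (ext_unit A A' g M m)"
    and u: "u \<in> carrier (ext_group A A' g M)"
  shows "h u = h' u"
proof (rule ext_group_ext[OF M _ _ _ _ u])
  show "abelian_group P" using P by (simp add: left_module_def)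
  show "h \<in> add_hom (ext_group A A' g M) P" "h' \<in> add_hom (ext_group A A' g M) P"
    using semilinear_add_hom[OF h] semilinear_add_hom[OF h'] by (simp_all add: add_hom_def)
  show "h (ext_pure A A' g M x m) = h' (ext_pure A A' g M x m)"
    if "x \<in> carrier A'" "m \<in> carrier M" for x m
    using that M by (simp add: ext_pure_eq_smult_unit semilinear_smult[OF h] semilinear_smult[OF h']
        ext_unit_closed eq)
qed

text \<open>The adjunction between extension and restriction of scalars, with an \<open>A\<close>-linear map into the
  restriction of \<open>P\<close> expressed as a \<open>g\<close>-semilinear map into \<open>P\<close>. Balancedness of
  \<open>(x, m) \<mapsto> x \<cdot> \<theta>(m)\<close> is precisely semilinearity of \<open>\<theta>\<close>.\<close>

lemma ext_adjunct:
  assumes M: "left_module A M" and P: "left_module A' P" and \<theta>: "\<theta> \<in> semilinear A g M P"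
  shows ext_adjunct_linear: "tensor_lift P (\<lambda>x m. x \<odot>\<^bsub>P\<^esub> \<theta> m) \<in> linear A' (ext_obj A A' g M) P"
    and ext_adjunct_unit: "m \<in> carrier M \<Longrightarrow> tensor_lift P (\<lambda>x m. x \<odot>\<^bsub>P\<^esub> \<theta> m) (ext_unit A A' g M m) = \<theta> m"
proof -
  have abP: "abelian_group P" using P by (simp add: left_module_def)
  note cl = semilinear_closed[OF \<theta>]
  have b: "balanced A A' (\<lambda>x a. x \<otimes>\<^bsub>A'\<^esub> g a) M P (\<lambda>x m. x \<odot>\<^bsub>P\<^esub> \<theta> m)"
    by (rule balancedI)
      (auto intro: add_hom_comp[OF semilinear_add_hom[OF \<theta>] left_module_smult_right[OF P]]
        left_module_smult_left[OF P cl]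
        simp: left_module.lsmult_assoc[OF P] semilinear_smult[OF \<theta>] g_closed cl)
  note lift = ext_lift_hom[OF M abP b] and pure = ext_lift_pure[OF M abP b]
  show "tensor_lift P (\<lambda>x m. x \<odot>\<^bsub>P\<^esub> \<theta> m) \<in> linear A' (ext_obj A A' g M) P"
  proof (rule semilinearI)
    show "tensor_lift P (\<lambda>x m. x \<odot>\<^bsub>P\<^esub> \<theta> m) \<in> add_hom (ext_obj A A' g M) P"
      using lift by (simp add: add_hom_def)
    fix a u assume a: "a \<in> carrier A'" and "u \<in> carrier (ext_obj A A' g M)"
    then have u: "u \<in> carrier (ext_group A A' g M)" by simp
    have s: "(\<odot>\<^bsub>ext_obj A A' g M\<^esub>) a \<in> add_hom (ext_group A A' g M) (ext_group A A' g M)"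
      using left_module_smult_right[OF left_module_ext_obj[OF M] a] by (simp add: add_hom_def)
    show "tensor_lift P (\<lambda>x m. x \<odot>\<^bsub>P\<^esub> \<theta> m) (a \<odot>\<^bsub>ext_obj A A' g M\<^esub> u)
        = a \<odot>\<^bsub>P\<^esub> tensor_lift P (\<lambda>x m. x \<odot>\<^bsub>P\<^esub> \<theta> m) u"
      by (rule ext_group_ext[OF M abP add_hom_comp[OF s lift] add_hom_comp[OF lift left_module_smult_right[OF P a]] _ u])
        (simp add: ext_smult_pure[OF M a] pure left_module.lsmult_assoc[OF P] a cl)
  qed
  show "tensor_lift P (\<lambda>x m. x \<odot>\<^bsub>P\<^esub> \<theta> m) (ext_unit A A' g M m) = \<theta> m" if "m \<in> carrier M"
    using that by (simp add: ext_unit_def pure left_module.lsmult_one[OF P] cl)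
qed

lemma ext_map:
  assumes M: "left_module A M" and N: "left_module A N" and h: "h \<in> linear A M N"
  defines "F \<equiv> tensor_lift (ext_group A A' g N) (\<lambda>x m. ext_pure A A' g N x (h m))"
  shows ext_map_linear: "F \<in> linear A' (ext_obj A A' g M) (ext_obj A A' g N)"
    and ext_map_unit: "m \<in> carrier M \<Longrightarrow> F (ext_unit A A' g M m) = ext_unit A A' g N (h m)"
proof -
  let ?GM = "ext_group A A' g M" and ?GN = "ext_group A A' g N"
  note G = ext_group_abelian_group[OF N] and b = ext_pure_balanced[OF N] and cl = semilinear_closed[OF h]
  have b: "balanced A A' (\<lambda>x a. x \<otimes>\<^bsub>A'\<^esub> g a) M ?GN (\<lambda>x m. ext_pure A A' g N x (h m))"
    by (rule balancedI)
      (auto intro: add_hom_comp[OF semilinear_add_hom[OF h] balanced_right[OF b]] balanced_left[OF b cl]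
        simp: semilinear_smult[OF h] balanced_swap[OF b] cl)
  have pure: "F (ext_pure A A' g M x m) = ext_pure A A' g N x (h m)"
    if "x \<in> carrier A'" "m \<in> carrier M" for x m
    unfolding F_def by (rule ext_lift_pure[OF M G b that])
  have lift: "F \<in> add_hom ?GM ?GN"
    unfolding F_def by (rule ext_lift_hom[OF M G b])
  show "F \<in> linear A' (ext_obj A A' g M) (ext_obj A A' g N)"
  proof (rule semilinearI)
    show "F \<in> add_hom (ext_obj A A' g M) (ext_obj A A' g N)"
      using lift by (simp add: add_hom_def)
    fix a u assume a: "a \<in> carrier A'" and "u \<in> carrier (ext_obj A A' g M)"
    then have u: "u \<in> carrier ?GM" by simp
    have s: "(\<odot>\<^bsub>ext_obj A A' g M\<^esub>) a \<in> add_hom ?GM ?GM" "(\<odot>\<^bsub>ext_obj A A' g N\<^esub>) a \<in> add_hom ?GN ?GN"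
      using left_module_smult_right[OF left_module_ext_obj[OF M] a]
        left_module_smult_right[OF left_module_ext_obj[OF N] a] by (simp_all add: add_hom_def)
    show "F (a \<odot>\<^bsub>ext_obj A A' g M\<^esub> u) = a \<odot>\<^bsub>ext_obj A A' g N\<^esub> F u"
      by (rule ext_group_ext[OF M G add_hom_comp[OF s(1) lift] add_hom_comp[OF lift s(2)] _ u])
        (simp add: ext_smult_pure[OF M a] ext_smult_pure[OF N a] pure a cl)
  qed
  show "F (ext_unit A A' g M m) = ext_unit A A' g N (h m)" if "m \<in> carrier M"
    using that by (simp add: ext_unit_def pure)
qed

end

section \<open>The action of \<open>B\<close>-modules on \<open>E\<close>-modules\<close>

lemma underlying_simps [simp]:
  "carrier (underlying A M) = carrier M"
  "add (underlying A M) = add M"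
  "\<zero>\<^bsub>underlying A M\<^esub> = \<zero>\<^bsub>M\<^esub>"
  "c \<odot>\<^bsub>underlying A M\<^esub> x = (c \<odot>\<^bsub>A\<^esub> \<one>\<^bsub>A\<^esub>) \<odot>\<^bsub>M\<^esub> x"
  by (simp_all add: underlying_def ring.defs module.defs)

lemma left_module_abelian_group: "left_module A M \<Longrightarrow> abelian_group M"
  by (simp add: left_module_def)

lemma k_algebra_ring: "k_algebra k A \<Longrightarrow> ring A"
  by (simp add: k_algebra_def)

lemma k_algebra_smult_closed:
  "\<lbrakk>k_algebra k A; c \<in> carrier k; a \<in> carrier A\<rbrakk> \<Longrightarrow> c \<odot>\<^bsub>A\<^esub> a \<in> carrier A"
  by (auto simp: k_algebra_def intro: module.smult_closed)

lemma k_algebra_scalar_mult: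
  assumes "k_algebra k A" "c \<in> carrier k" "a \<in> carrier A"
  shows "(c \<odot>\<^bsub>A\<^esub> \<one>\<^bsub>A\<^esub>) \<otimes>\<^bsub>A\<^esub> a = c \<odot>\<^bsub>A\<^esub> a" "a \<otimes>\<^bsub>A\<^esub> (c \<odot>\<^bsub>A\<^esub> \<one>\<^bsub>A\<^esub>) = c \<odot>\<^bsub>A\<^esub> a"
proof -
  interpret A: ring A by (rule k_algebra_ring[OF assms(1)])
  show "(c \<odot>\<^bsub>A\<^esub> \<one>\<^bsub>A\<^esub>) \<otimes>\<^bsub>A\<^esub> a = c \<odot>\<^bsub>A\<^esub> a" "a \<otimes>\<^bsub>A\<^esub> (c \<odot>\<^bsub>A\<^esub> \<one>\<^bsub>A\<^esub>) = c \<odot>\<^bsub>A\<^esub> a"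
    using assms by (auto simp: k_algebra_def)
qed

lemma kspace_k_algebra: "k_algebra k A \<Longrightarrow> kspace k A"
  by (simp add: kspace_def kspace_axioms_def k_algebra_smult_closed ring.is_abelian_group k_algebra_ring)

lemma kspace_underlying:
  assumes A: "k_algebra k A" and M: "left_module A M"
  shows "kspace k (underlying A M)"
proof -
  interpret A: ring A by (rule k_algebra_ring[OF A])
  have "abelian_group (underlying A M)"
    by (rule abelian_group_cong[OF left_module_abelian_group[OF M]]) simp_all
  then show ?thesis
    by (simp add: kspace_def kspace_axioms_def left_module.lsmult_closed[OF M] k_algebra_smult_closed[OF A])
qed

text \<open>Scalars from \<open>k\<close> are central in \<open>A\<close>, so the action is \<open>k\<close>-linear also in the module variable.\<close>

lemma bilinear_smult:
  assumes A: "k_algebra k A" and M: "left_module A M"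
  shows "smult M \<in> bilinear k A (underlying A M) (underlying A M)"
proof -
  interpret A: ring A by (rule k_algebra_ring[OF A])
  note sm = left_module.lsmult_assoc[OF M, symmetric] k_algebra_smult_closed[OF A] k_algebra_scalar_mult[OF A]
  show ?thesis
    unfolding bilinear_def
    using left_module_smult_right[OF M] left_module_smult_left[OF M]
    by (auto intro!: semilinearI simp: sm add_hom_def)
qed

lemma bilinear_mult:
  assumes A: "k_algebra k A"
  shows "monoid.mult A \<in> bilinear k A A A"
proof -
  interpret A: ring A by (rule k_algebra_ring[OF A])
  show ?thesis
    unfolding bilinear_def
    using A by (auto intro!: semilinearI add_homI simp: A.l_distr A.r_distr k_algebra_def)
qed

lemma algebra_map_linear: "algebra_map k A A' f \<Longrightarrow> f \<in> linear k A A'"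
  by (auto simp: algebra_map_def intro!: semilinearI add_homI elim: ring_hom_closed ring_hom_add)

lemma semilinear_underlying:
  assumes A: "k_algebra k A" and A': "k_algebra k A'" and f: "algebra_map k A A' f"
    and g: "g \<in> semilinear A f M N"
  shows "g \<in> linear k (underlying A M) (underlying A' N)"
proof (rule semilinearI)
  interpret A: ring A by (rule k_algebra_ring[OF A])
  show "g \<in> add_hom (underlying A M) (underlying A' N)"
    using semilinear_add_hom[OF g] by (simp add: add_hom_def)
  have "f (c \<odot>\<^bsub>A\<^esub> \<one>\<^bsub>A\<^esub>) = c \<odot>\<^bsub>A'\<^esub> \<one>\<^bsub>A'\<^esub>" if "c \<in> carrier k" for c
    using that f by (auto simp: algebra_map_def dest: ring_hom_one)
  then show "g (c \<odot>\<^bsub>underlying A M\<^esub> x) = c \<odot>\<^bsub>underlying A' N\<^esub> g x"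
    if "c \<in> carrier k" "x \<in> carrier (underlying A M)" for c x
    using that by (simp add: semilinear_smult[OF g] k_algebra_smult_closed[OF A])
qed

lemma tensor_algebra_simps [simp]:
  "carrier (tensor_algebra k A B) = carrier (kgroup k A B)"
  "add (tensor_algebra k A B) = add (kgroup k A B)"
  "\<one>\<^bsub>tensor_algebra k A B\<^esub> = kpure k A B \<one>\<^bsub>A\<^esub> \<one>\<^bsub>B\<^esub>"
  "u \<otimes>\<^bsub>tensor_algebra k A B\<^esub> v = tensor_bilinear k A B (monoid.mult A) (monoid.mult B) u v"
  by (simp_all add: tensor_algebra_def ktensor_def tensor_bilinear_def ring.defs module.defs)

lemma tensor_map:
  assumes sp: "kspace k X" "kspace k Y" "kspace k X'" "kspace k Y'"
    and g: "g \<in> linear k X X'" and h: "h \<in> linear k Y Y'"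
  defines "G \<equiv> tensor_lift (kgroup k X' Y') (\<lambda>x y. kpure k X' Y' (g x) (h y))"
  shows tensor_map_add_hom: "G \<in> add_hom (kgroup k X Y) (kgroup k X' Y')"
    and tensor_map_pure: "\<lbrakk>x \<in> carrier X; y \<in> carrier Y\<rbrakk> \<Longrightarrow> G (kpure k X Y x y) = kpure k X' Y' (g x) (h y)"
proof -
  note l = sp(1,2) kgroup_abelian_group[OF sp(3,4)] tensor_map_balanced[OF sp(3,4) g h]
  show "G \<in> add_hom (kgroup k X Y) (kgroup k X' Y')"
    unfolding G_def by (rule klift_hom[OF l])
  show "G (kpure k X Y x y) = kpure k X' Y' (g x) (h y)" if "x \<in> carrier X" "y \<in> carrier Y"
    unfolding G_def by (rule klift_pure[OF l that])
qed

text \<open>If \<open>g\<close> intertwines \<open>\<mu>\<close> with \<open>\<mu>'\<close> along \<open>(g\<^sub>1, g\<^sub>2)\<close> and \<open>h\<close> intertwines \<open>\<nu>\<close> with \<open>\<nu>'\<close> along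
  \<open>(h\<^sub>1, h\<^sub>2)\<close>, then \<open>g \<otimes> h\<close> intertwines the induced maps on tensor products along
  \<open>(g\<^sub>1 \<otimes> h\<^sub>1, g\<^sub>2 \<otimes> h\<^sub>2)\<close>. Both sides are biadditive, and on pure tensors the equation is
  the hypothesis.\<close>

lemma tensor_map_bilinear:
  assumes sp1: "kspace k X1" "kspace k Y1" "kspace k X1'" "kspace k Y1'"
    and sp2: "kspace k X2" "kspace k Y2" "kspace k X2'" "kspace k Y2'"
    and sp: "kspace k X" "kspace k Y" "kspace k X'" "kspace k Y'"
    and \<mu>: "\<mu> \<in> bilinear k X1 X2 X" and \<nu>: "\<nu> \<in> bilinear k Y1 Y2 Y"
    and \<mu>': "\<mu>' \<in> bilinear k X1' X2' X'" and \<nu>': "\<nu>' \<in> bilinear k Y1' Y2' Y'"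
    and lin1: "g1 \<in> linear k X1 X1'" "h1 \<in> linear k Y1 Y1'"
    and lin2: "g2 \<in> linear k X2 X2'" "h2 \<in> linear k Y2 Y2'"
    and lin: "g \<in> linear k X X'" "h \<in> linear k Y Y'"
    and g: "\<And>x1 x2. \<lbrakk>x1 \<in> carrier X1; x2 \<in> carrier X2\<rbrakk> \<Longrightarrow> g (\<mu> x1 x2) = \<mu>' (g1 x1) (g2 x2)"
    and h: "\<And>y1 y2. \<lbrakk>y1 \<in> carrier Y1; y2 \<in> carrier Y2\<rbrakk> \<Longrightarrow> h (\<nu> y1 y2) = \<nu>' (h1 y1) (h2 y2)"
    and u: "u \<in> carrier (kgroup k X1 Y1)" and v: "v \<in> carrier (kgroup k X2 Y2)"
  shows "tensor_lift (kgroup k X' Y') (\<lambda>x y. kpure k X' Y' (g x) (h y)) (tensor_bilinear k X Y \<mu> \<nu> u v)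
    = tensor_bilinear k X' Y' \<mu>' \<nu>'
        (tensor_lift (kgroup k X1' Y1') (\<lambda>x y. kpure k X1' Y1' (g1 x) (h1 y)) u)
        (tensor_lift (kgroup k X2' Y2') (\<lambda>x y. kpure k X2' Y2' (g2 x) (h2 y)) v)"
proof -
  let ?G = "tensor_lift (kgroup k X' Y') (\<lambda>x y. kpure k X' Y' (g x) (h y))"
  let ?G1 = "tensor_lift (kgroup k X1' Y1') (\<lambda>x y. kpure k X1' Y1' (g1 x) (h1 y))"
  let ?G2 = "tensor_lift (kgroup k X2' Y2') (\<lambda>x y. kpure k X2' Y2' (g2 x) (h2 y))"
  let ?b = "tensor_bilinear k X Y \<mu> \<nu>" and ?b' = "tensor_bilinear k X' Y' \<mu>' \<nu>'"
  note b = tensor_bilinear_left[OF sp1(1,2) sp2(1,2) sp(1,2) \<mu> \<nu>]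
    tensor_bilinear_right[OF sp1(1,2) sp2(1,2) sp(1,2) \<mu> \<nu>]
    tensor_bilinear_pure[OF sp1(1,2) sp2(1,2) sp(1,2) \<mu> \<nu>]
  note b' = tensor_bilinear_left[OF sp1(3,4) sp2(3,4) sp(3,4) \<mu>' \<nu>']
    tensor_bilinear_right[OF sp1(3,4) sp2(3,4) sp(3,4) \<mu>' \<nu>']
    tensor_bilinear_pure[OF sp1(3,4) sp2(3,4) sp(3,4) \<mu>' \<nu>']
  note G = tensor_map_add_hom[OF sp lin] tensor_map_pure[OF sp lin]
  note G1 = tensor_map_add_hom[OF sp1 lin1] tensor_map_pure[OF sp1 lin1]
  note G2 = tensor_map_add_hom[OF sp2 lin2] tensor_map_pure[OF sp2 lin2]
  note H = kgroup_abelian_group[OF sp(3,4)]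
  show ?thesis
  proof (rule kgroup_ext[where g = "\<lambda>u. ?G (?b u v)" and h = "\<lambda>u. ?b' (?G1 u) (?G2 v)",
        OF sp1(1,2) H add_hom_comp[OF b(1)[OF v] G(1)]
        add_hom_comp[OF G1(1) b'(1)[OF add_hom_closed[OF G2(1) v]]] _ u])
    fix x1 y1 assume 1: "x1 \<in> carrier X1" "y1 \<in> carrier Y1"
    note p1 = kpure_closed[OF sp1(1,2) 1]
    show "?G (?b (kpure k X1 Y1 x1 y1) v) = ?b' (?G1 (kpure k X1 Y1 x1 y1)) (?G2 v)"
    proof (rule kgroup_ext[where g = "\<lambda>v. ?G (?b (kpure k X1 Y1 x1 y1) v)"
            and h = "\<lambda>v. ?b' (?G1 (kpure k X1 Y1 x1 y1)) (?G2 v)",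
          OF sp2(1,2) H add_hom_comp[OF b(2)[OF p1] G(1)]
          add_hom_comp[OF G2(1) b'(2)[OF add_hom_closed[OF G1(1) p1]]] _ v])
      fix x2 y2 assume 2: "x2 \<in> carrier X2" "y2 \<in> carrier Y2"
      have c: "\<mu> x1 x2 \<in> carrier X" "\<nu> y1 y2 \<in> carrier Y"
        using \<mu> \<nu> 1 2 by (auto simp: bilinear_def intro: semilinear_closed)
      show "?G (?b (kpure k X1 Y1 x1 y1) (kpure k X2 Y2 x2 y2))
        = ?b' (?G1 (kpure k X1 Y1 x1 y1)) (?G2 (kpure k X2 Y2 x2 y2))"
        using 1 2
        by (simp add: b(3) G(2)[OF c] G1(2) G2(2) b'(3) g h semilinear_closed[OF lin1(1)]
            semilinear_closed[OF lin1(2)] semilinear_closed[OF lin2(1)] semilinear_closed[OF lin2(2)])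
    qed
  qed
qed

lemma act_obj_simps [simp]:
  "carrier (act_obj k B E \<rho> N Q) = carrier (act_group k B E N Q)"
  "add (act_obj k B E \<rho> N Q) = add (act_group k B E N Q)"
  "\<zero>\<^bsub>act_obj k B E \<rho> N Q\<^esub> = \<zero>\<^bsub>act_group k B E N Q\<^esub>"
  by (simp_all add: act_obj_def ring.defs module.defs)

lemma act_obj_smult:
  "(\<odot>\<^bsub>act_obj k B E \<rho> N Q\<^esub>) e =
    tensor_bilinear k (underlying E N) (underlying B Q) (smult N) (smult Q) (\<rho> e)"
  by (simp add: act_obj_def ring.defs module.defs tensor_bilinear_def[abs_def] act_group_def act_pure_def)

locale coaction =
  fixes k :: "('k, 'c) ring_scheme" and B :: "('k, 'b, 'd) module_scheme"
    and E :: "('k, 'e, 'z) module_scheme" and \<rho> :: "'e \<Rightarrow> ('e, 'b) tens"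
  assumes alg_B: "k_algebra k B" and alg_E: "k_algebra k E"
    and \<rho>: "algebra_map k E (tensor_algebra k E B) \<rho>"
begin

sublocale B: ring B by (rule k_algebra_ring[OF alg_B])
sublocale E: ring E by (rule k_algebra_ring[OF alg_E])

lemma \<rho>_ring_hom: "\<rho> \<in> ring_hom E (tensor_algebra k E B)"
  using \<rho> by (simp add: algebra_map_def)

lemma \<rho>_closed: "e \<in> carrier E \<Longrightarrow> \<rho> e \<in> carrier (kgroup k E B)"
  using ring_hom_closed[OF \<rho>_ring_hom] by simp

lemma \<rho>_add_hom: "\<rho> \<in> add_hom E (kgroup k E B)"
  using \<rho>_closed ring_hom_add[OF \<rho>_ring_hom] by (auto intro: add_homI)

lemmas sp_EB = kspace_k_algebra[OF alg_E] kspace_k_algebra[OF alg_B]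
lemmas sp_N = kspace_underlying[OF alg_E]
lemmas sp_Q = kspace_underlying[OF alg_B]

lemmas act_group_abelian_group = kgroup_abelian_group[OF sp_N sp_Q, folded act_group_def act_pure_def]
lemmas act_pure_closed = kpure_closed[OF sp_N sp_Q, folded act_group_def act_pure_def, unfolded underlying_simps]
lemmas act_group_ext = kgroup_ext[OF sp_N sp_Q, folded act_group_def act_pure_def, unfolded underlying_simps]

text \<open>The algebra \<open>E \<otimes> B\<close> acts on \<open>N \<otimes> Q\<close> componentwise, and the action of \<open>E\<close> is the pullback of this
  one along \<open>\<rho>\<close>.\<close>

lemma left_module_act_obj:
  assumes N: "left_module E N" and Q: "left_module B Q"
  shows "left_module E (act_obj k B E \<rho> N Q)"
proof -
  let ?G = "act_group k B E N Q" and ?P = "act_obj k B E \<rho> N Q" and ?p = "act_pure k B E N Q"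
  let ?b = "tensor_bilinear k (underlying E N) (underlying B Q) (smult N) (smult Q)"
  let ?EB = "kgroup k E B" and ?m = "tensor_bilinear k E B (monoid.mult E) (monoid.mult B)"
  interpret N: left_module E N by fact
  interpret Q: left_module B Q by fact
  note sp = sp_EB sp_N[OF N] sp_Q[OF Q] sp_N[OF N] sp_Q[OF Q] bilinear_smult[OF alg_E N] bilinear_smult[OF alg_B Q]
  note b = tensor_bilinear_left[OF sp, folded act_group_def act_pure_def]
    tensor_bilinear_right[OF sp, folded act_group_def act_pure_def]
    tensor_bilinear_pure[OF sp, folded act_group_def act_pure_def, unfolded underlying_simps]
  note spm = sp_EB sp_EB sp_EB bilinear_mult[OF alg_E] bilinear_mult[OF alg_B]
  note m = tensor_bilinear_left[OF spm] tensor_bilinear_right[OF spm] tensor_bilinear_pure[OF spm]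
  note G = act_group_abelian_group[OF N Q]
  note ext = act_group_ext[OF N Q G]
  have assoc: "?b (?m u v) w = ?b u (?b v w)"
    if u: "u \<in> carrier ?EB" and v: "v \<in> carrier ?EB" and w: "w \<in> carrier ?G" for u v w
  proof (rule kgroup_ext[OF sp_EB G add_hom_comp[OF m(1)[OF v] b(1)[OF w]]
        b(1)[OF add_hom_closed[OF b(2)[OF v] w]] _ u])
    fix e1 b1 assume 1: "e1 \<in> carrier E" "b1 \<in> carrier B"
    let ?u = "kpure k E B e1 b1"
    have u: "?u \<in> carrier ?EB" by (rule kpure_closed[OF sp_EB 1])
    show "?b (?m ?u v) w = ?b ?u (?b v w)"
    proof (rule kgroup_ext[OF sp_EB G add_hom_comp[OF m(2)[OF u] b(1)[OF w]]
          add_hom_comp[OF b(1)[OF w] b(2)[OF u]] _ v])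
      fix e2 b2 assume 2: "e2 \<in> carrier E" "b2 \<in> carrier B"
      let ?v = "kpure k E B e2 b2"
      have v: "?v \<in> carrier ?EB" by (rule kpure_closed[OF sp_EB 2])
      have uv: "?m ?u ?v \<in> carrier ?EB" by (rule add_hom_closed[OF m(2)[OF u] v])
      show "?b (?m ?u ?v) w = ?b ?u (?b ?v w)"
        by (rule ext[OF b(2)[OF uv] add_hom_comp[OF b(2)[OF v] b(2)[OF u]] _ w])
          (use 1 2 in \<open>simp add: m(3) b(3) N.lsmult_closed Q.lsmult_closed N.lsmult_assoc Q.lsmult_assoc\<close>)
    qed
  qed
  show ?thesis
  proof (intro left_module.intro left_module_axioms.intro)
    show "ring E" by (rule E.ring_axioms)
    show "abelian_group ?P" by (rule abelian_group_cong[OF G]) simp_all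
  next
    fix e w assume "e \<in> carrier E" "w \<in> carrier ?P"
    then show "e \<odot>\<^bsub>?P\<^esub> w \<in> carrier ?P"
      using add_hom_closed[OF b(2)[OF \<rho>_closed]] by (simp add: act_obj_smult)
  next
    fix e e' w assume "e \<in> carrier E" "e' \<in> carrier E" "w \<in> carrier ?P"
    then show "(e \<oplus>\<^bsub>E\<^esub> e') \<odot>\<^bsub>?P\<^esub> w = e \<odot>\<^bsub>?P\<^esub> w \<oplus>\<^bsub>?P\<^esub> e' \<odot>\<^bsub>?P\<^esub> w"
      using add_hom_add[OF add_hom_comp[OF \<rho>_add_hom b(1)]] by (simp add: act_obj_smult)
  next
    fix e w w' assume "e \<in> carrier E" "w \<in> carrier ?P" "w' \<in> carrier ?P"
    then show "e \<odot>\<^bsub>?P\<^esub> (w \<oplus>\<^bsub>?P\<^esub> w') = e \<odot>\<^bsub>?P\<^esub> w \<oplus>\<^bsub>?P\<^esub> e \<odot>\<^bsub>?P\<^esub> w'"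
      using add_hom_add[OF b(2)[OF \<rho>_closed]] by (simp add: act_obj_smult)
  next
    fix e e' w assume "e \<in> carrier E" "e' \<in> carrier E" "w \<in> carrier ?P"
    then show "(e \<otimes>\<^bsub>E\<^esub> e') \<odot>\<^bsub>?P\<^esub> w = e \<odot>\<^bsub>?P\<^esub> (e' \<odot>\<^bsub>?P\<^esub> w)"
      by (simp add: act_obj_smult ring_hom_mult[OF \<rho>_ring_hom] assoc \<rho>_closed)
  next
    fix w assume "w \<in> carrier ?P"
    then have w: "w \<in> carrier ?G" by simp
    have "\<rho> \<one>\<^bsub>E\<^esub> = kpure k E B \<one>\<^bsub>E\<^esub> \<one>\<^bsub>B\<^esub>"
      using ring_hom_one[OF \<rho>_ring_hom] by simp
    moreover have "?b (kpure k E B \<one>\<^bsub>E\<^esub> \<one>\<^bsub>B\<^esub>) w = w"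
    proof (rule ext[OF b(2)[OF kpure_closed[OF sp_EB]] _ _ w])
      show "(\<lambda>w. w) \<in> add_hom ?G ?G" by (simp add: add_hom_def)
    qed (simp_all add: b(3) N.lsmult_one Q.lsmult_one)
    ultimately show "\<one>\<^bsub>E\<^esub> \<odot>\<^bsub>?P\<^esub> w = w"
      by (simp add: act_obj_smult)
  qed
qed

end

text \<open>The heart of the matter. For \<open>f\<close> and \<open>\<phi>\<close> identities this is functoriality of \<open>\<triangleleft>\<close>; for \<open>g\<close> and
  \<open>h\<close> the units of extension of scalars it gives the semilinear map behind the transformation.\<close>

lemma act_map:
  assumes "coaction k B E \<rho>" "coaction k B' E' \<rho>'"
    and f: "algebra_map k E E' f" and \<phi>: "algebra_map k B B' \<phi>"
    and \<rho>f: "\<And>e. e \<in> carrier E \<Longrightarrow>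
      \<rho>' (f e) = tensor_lift (kgroup k E' B') (\<lambda>e0 e1. kpure k E' B' (f e0) (\<phi> e1)) (\<rho> e)"
    and N: "left_module E N" and Q: "left_module B Q" and N': "left_module E' N'" and Q': "left_module B' Q'"
    and g: "g \<in> semilinear E f N N'" and h: "h \<in> semilinear B \<phi> Q Q'"
  defines "G \<equiv> tensor_lift (act_group k B' E' N' Q') (\<lambda>n q. act_pure k B' E' N' Q' (g n) (h q))"
  shows act_map_semilinear: "G \<in> semilinear E f (act_obj k B E \<rho> N Q) (act_obj k B' E' \<rho>' N' Q')"
    and act_map_pure: "\<lbrakk>n \<in> carrier N; q \<in> carrier Q\<rbrakk>
      \<Longrightarrow> G (act_pure k B E N Q n q) = act_pure k B' E' N' Q' (g n) (h q)"
proof -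
  interpret E: coaction k B E \<rho> by fact
  interpret E': coaction k B' E' \<rho>' by fact
  note sp = E.sp_N[OF N] E.sp_Q[OF Q] E'.sp_N[OF N'] E'.sp_Q[OF Q']
  note lin = semilinear_underlying[OF E.alg_E E'.alg_E f g] semilinear_underlying[OF E.alg_B E'.alg_B \<phi> h]
  show "G (act_pure k B E N Q n q) = act_pure k B' E' N' Q' (g n) (h q)"
    if "n \<in> carrier N" "q \<in> carrier Q"
    using tensor_map_pure[OF sp lin] that by (simp add: G_def act_group_def act_pure_def)
  show "G \<in> semilinear E f (act_obj k B E \<rho> N Q) (act_obj k B' E' \<rho>' N' Q')"
  proof (rule semilinearI)
    show "G \<in> add_hom (act_obj k B E \<rho> N Q) (act_obj k B' E' \<rho>' N' Q')"
      using tensor_map_add_hom[OF sp lin] by (simp add: G_def act_group_def act_pure_def add_hom_def)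
    fix e w assume e: "e \<in> carrier E" and w: "w \<in> carrier (act_obj k B E \<rho> N Q)"
    show "G (e \<odot>\<^bsub>act_obj k B E \<rho> N Q\<^esub> w) = f e \<odot>\<^bsub>act_obj k B' E' \<rho>' N' Q'\<^esub> G w"
      unfolding act_obj_smult \<rho>f[OF e] G_def act_group_def act_pure_def
      by (rule tensor_map_bilinear[OF E.sp_EB E'.sp_EB sp sp
            bilinear_smult[OF E.alg_E N] bilinear_smult[OF E.alg_B Q]
            bilinear_smult[OF E'.alg_E N'] bilinear_smult[OF E'.alg_B Q']
            algebra_map_linear[OF f] algebra_map_linear[OF \<phi>] lin lin])
        (use e w in \<open>simp_all add: semilinear_smult[OF g] semilinear_smult[OF h] E.\<rho>_closed act_group_def\<close>)
  qed
qed

section \<open>Functors\<close>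

lemma LMod_simps [simp]:
  "Obj (LMod R) = {M. left_module R M}"
  "Arr (LMod R) = lmod_hom R"
  "Ide (LMod R) M = (\<lambda>x\<in>carrier M. x)"
  "Cmp (LMod R) M N P g h = compose (carrier M) g h"
  by (simp_all add: LMod_def)

lemma prod_category_simps [simp]:
  "Obj (prod_category C D) = Obj C \<times> Obj D"
  "Arr (prod_category C D) X Y = Arr C (fst X) (fst Y) \<times> Arr D (snd X) (snd Y)"
  "Ide (prod_category C D) X = (Ide C (fst X), Ide D (snd X))"
  "Cmp (prod_category C D) X Y Z g h = (Cmp C (fst X) (fst Y) (fst Z) (fst g) (fst h),
                          Cmp D (snd X) (snd Y) (snd Z) (snd g) (snd h))"
  by (simp_all add: prod_category_def)

lemma functor_comp_simps [simp]:
  "FObj (G \<circ>\<^sub>F F) X = FObj G (FObj F X)"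
  "FArr (G \<circ>\<^sub>F F) X Y h = FArr G (FObj F X) (FObj F Y) (FArr F X Y h)"
  by (simp_all add: functor_comp_def)

lemma functor_prod_simps [simp]:
  "FObj (F \<times>\<^sub>F G) X = (FObj F (fst X), FObj G (snd X))"
  "FArr (F \<times>\<^sub>F G) X Y h = (FArr F (fst X) (fst Y) (fst h), FArr G (snd X) (snd Y) (snd h))"
  by (simp_all add: functor_prod_def)

lemma lmod_hom_linear: "h \<in> lmod_hom R M N \<Longrightarrow> h \<in> linear R M N"
  by (simp add: lmod_hom_iff)

lemma lmod_hom_closed: "\<lbrakk>h \<in> lmod_hom R M N; x \<in> carrier M\<rbrakk> \<Longrightarrow> h x \<in> carrier N"
  by (auto dest: lmod_hom_linear intro: semilinear_closed)

lemma lmod_hom_eqI: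
  assumes "h \<in> lmod_hom R M N" "h' \<in> lmod_hom R M N" "\<And>x. x \<in> carrier M \<Longrightarrow> h x = h' x"
  shows "h = h'"
  using assms by (auto simp: lmod_hom_iff intro: extensionalityI)

lemma restrict_linear_lmod_hom:
  "\<lbrakk>left_module R M; h \<in> linear R M N\<rbrakk> \<Longrightarrow> restrict h (carrier M) \<in> lmod_hom R M N"
  by (rule restrict_lmod_hom[OF left_module_abelian_group left_module.lsmult_closed])

lemma lmod_hom_ident: "left_module R M \<Longrightarrow> (\<lambda>x\<in>carrier M. x) \<in> lmod_hom R M M"
  by (rule restrict_linear_lmod_hom) (auto simp: semilinear_def add_hom_def)

lemma semilinear_linear_comp:
  assumes "g \<in> semilinear R f M N" "h \<in> linear S N P" "\<And>r. r \<in> carrier R \<Longrightarrow> f r \<in> carrier S"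
  shows "(\<lambda>x. h (g x)) \<in> semilinear R f M P"
  using assms by (auto intro!: semilinearI intro: add_hom_comp semilinear_add_hom
      simp: semilinear_smult semilinear_closed)

lemma lmod_hom_compose:
  assumes "left_module R M" "h \<in> lmod_hom R M N" "g \<in> lmod_hom R N P"
  shows "compose (carrier M) g h \<in> lmod_hom R M P"
  unfolding compose_def
  by (rule restrict_linear_lmod_hom[OF assms(1)])
    (rule semilinear_linear_comp[OF lmod_hom_linear[OF assms(2)] lmod_hom_linear[OF assms(3)]])

lemma is_category_LMod: "is_category (LMod R)"
  unfolding is_category_def LMod_simps
proof (intro conjI ballI)
  fix M N P Q h g l
  assume "M \<in> {M. left_module R M}" "N \<in> {M. left_module R M}" "P \<in> {M. left_module R M}"
    "Q \<in> {M. left_module R M}" "h \<in> lmod_hom R M N" "g \<in> lmod_hom R N P" "l \<in> lmod_hom R P Q"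
  then show "compose (carrier M) l (compose (carrier M) g h) = compose (carrier M) (compose (carrier N) l g) h"
    by (intro extensionalityI[OF compose_extensional compose_extensional]) (simp add: compose_eq lmod_hom_closed)
next
  fix M N h assume "M \<in> {M. left_module R M}" "N \<in> {M. left_module R M}" and h: "h \<in> lmod_hom R M N"
  then have ext: "h \<in> extensional (carrier M)" and cl: "\<And>x. x \<in> carrier M \<Longrightarrow> h x \<in> carrier N"
    using lmod_hom_closed[OF h] by (auto simp: lmod_hom_iff)
  show "compose (carrier M) h (\<lambda>x\<in>carrier M. x) = h"
    by (rule extensionalityI[OF compose_extensional ext]) (simp add: compose_eq)
  show "compose (carrier M) (\<lambda>x\<in>carrier N. x) h = h"
    by (rule extensionalityI[OF compose_extensional ext]) (simp add: compose_eq cl)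
qed (simp_all add: lmod_hom_ident lmod_hom_compose)

lemma is_category_prod: "\<lbrakk>is_category C; is_category D\<rbrakk> \<Longrightarrow> is_category (prod_category C D)"
  by (auto simp: is_category_def)

lemma is_functor_comp: "\<lbrakk>is_functor D E G; is_functor C D F\<rbrakk> \<Longrightarrow> is_functor C E (G \<circ>\<^sub>F F)"
  by (simp add: is_functor_def)

lemma is_functor_prod:
  "\<lbrakk>is_functor C C' F; is_functor D D' G\<rbrakk> \<Longrightarrow> is_functor (prod_category C D) (prod_category C' D') (F \<times>\<^sub>F G)"
  by (auto simp: is_functor_def is_category_prod)

lemma ext_scalars_simps [simp]:
  "FObj (ext_scalars A A' g) = ext_obj A A' g"
  "FArr (ext_scalars A A' g) M N h = (\<lambda>u\<in>carrier (ext_obj A A' g M).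
      tensor_lift (ext_group A A' g N) (\<lambda>x m. ext_pure A A' g N x (h m)) u)"
  by (simp_all add: ext_scalars_def)

context scalar_ext
begin

lemma ext_lmod_hom_eqI:
  assumes M: "left_module A M" and P: "left_module A' P"
    and h: "h \<in> lmod_hom A' (ext_obj A A' g M) P" "h' \<in> lmod_hom A' (ext_obj A A' g M) P"
    and eq: "\<And>m. m \<in> carrier M \<Longrightarrow> h (ext_unit A A' g M m) = h' (ext_unit A A' g M m)"
  shows "h = h'"
  using ext_obj_linear_ext[OF M P lmod_hom_linear[OF h(1)] lmod_hom_linear[OF h(2)] eq]
  by (intro lmod_hom_eqI[OF h]) simp

lemma ext_arr:
  assumes M: "left_module A M" and N: "left_module A N" and h: "h \<in> lmod_hom A M N"
  shows ext_arr_lmod_hom: "FArr (ext_scalars A A' g) M N h \<in> lmod_hom A' (ext_obj A A' g M) (ext_obj A A' g N)"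
    and ext_arr_unit: "m \<in> carrier M
      \<Longrightarrow> FArr (ext_scalars A A' g) M N h (ext_unit A A' g M m) = ext_unit A A' g N (h m)"
  using restrict_linear_lmod_hom[OF left_module_ext_obj[OF M] ext_map_linear[OF M N lmod_hom_linear[OF h]]]
    ext_map_unit[OF M N lmod_hom_linear[OF h]]
  by (simp_all add: ext_unit_closed[OF M])

lemma is_functor_ext_scalars:
  "is_functor (LMod A) (LMod A') (ext_scalars A A' g)"
  unfolding is_functor_def
proof (intro conjI ballI; (rule is_category_LMod)?)
  fix M :: "('a, 'm) module" assume "M \<in> Obj (LMod A)"
  then have M: "left_module A M" by simp
  show "FObj (ext_scalars A A' g) M \<in> Obj (LMod A')"
    using left_module_ext_obj[OF M] by simp
  have "FArr (ext_scalars A A' g) M M (\<lambda>x\<in>carrier M. x) = (\<lambda>x\<in>carrier (ext_obj A A' g M). x)"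
    by (rule ext_lmod_hom_eqI[OF M left_module_ext_obj[OF M]
          ext_arr_lmod_hom[OF M M lmod_hom_ident[OF M]] lmod_hom_ident[OF left_module_ext_obj[OF M]]])
      (simp add: ext_arr_unit[OF M M lmod_hom_ident[OF M]] ext_unit_closed[OF M] del: ext_scalars_simps(2))
  then show "FArr (ext_scalars A A' g) M M (Ide (LMod A) M) = Ide (LMod A') (FObj (ext_scalars A A' g) M)"
    by simp
  fix N :: "('a, 'm) module" assume "N \<in> Obj (LMod A)"
  then have N: "left_module A N" by simp
  fix h assume "h \<in> Arr (LMod A) M N"
  then have h: "h \<in> lmod_hom A M N" by simp
  show "FArr (ext_scalars A A' g) M N h
      \<in> Arr (LMod A') (FObj (ext_scalars A A' g) M) (FObj (ext_scalars A A' g) N)"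
    using ext_arr_lmod_hom[OF M N h] by simp
  fix P :: "('a, 'm) module" assume "P \<in> Obj (LMod A)"
  then have P: "left_module A P" by simp
  fix l assume "l \<in> Arr (LMod A) N P"
  then have l: "l \<in> lmod_hom A N P" by simp
  note lh = lmod_hom_compose[OF M h l]
  have "FArr (ext_scalars A A' g) M P (compose (carrier M) l h)
    = compose (carrier (ext_obj A A' g M)) (FArr (ext_scalars A A' g) N P l) (FArr (ext_scalars A A' g) M N h)"
    by (rule ext_lmod_hom_eqI[OF M left_module_ext_obj[OF P] ext_arr_lmod_hom[OF M P lh]
          lmod_hom_compose[OF left_module_ext_obj[OF M] ext_arr_lmod_hom[OF M N h] ext_arr_lmod_hom[OF N P l]]])
      (simp add: compose_eq ext_arr_unit[OF M P lh] ext_arr_unit[OF M N h] ext_arr_unit[OF N P l]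
        lmod_hom_closed[OF h] ext_unit_closed[OF M] del: ext_scalars_simps(2))
  then show "FArr (ext_scalars A A' g) M P (Cmp (LMod A) M N P l h)
    = Cmp (LMod A') (FObj (ext_scalars A A' g) M) (FObj (ext_scalars A A' g) N) (FObj (ext_scalars A A' g) P)
        (FArr (ext_scalars A A' g) N P l) (FArr (ext_scalars A A' g) M N h)"
    by simp
qed

end

lemma act_simps [simp]:
  "FObj (act k B E \<rho>) X = act_obj k B E \<rho> (fst X) (snd X)"
  "FArr (act k B E \<rho>) X Y h = (\<lambda>w\<in>carrier (act_obj k B E \<rho> (fst X) (snd X)).
      tensor_lift (act_group k B E (fst Y) (snd Y))
        (\<lambda>n q. act_pure k B E (fst Y) (snd Y) (fst h n) (snd h q)) w)"
  by (simp_all add: act_def split_beta)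

context coaction
begin

lemma act_lmod_hom_eqI:
  assumes N: "left_module E N" and Q: "left_module B Q" and P: "left_module E P"
    and h: "h \<in> lmod_hom E (act_obj k B E \<rho> N Q) P" "h' \<in> lmod_hom E (act_obj k B E \<rho> N Q) P"
    and eq: "\<And>n q. \<lbrakk>n \<in> carrier N; q \<in> carrier Q\<rbrakk> \<Longrightarrow> h (act_pure k B E N Q n q) = h' (act_pure k B E N Q n q)"
  shows "h = h'"
proof (rule lmod_hom_eqI[OF h])
  have "h \<in> add_hom (act_group k B E N Q) P" "h' \<in> add_hom (act_group k B E N Q) P"
    using h by (auto dest!: lmod_hom_linear semilinear_add_hom simp: add_hom_def)
  note * = act_group_ext[OF N Q left_module_abelian_group[OF P] this eq]
  show "h x = h' x" if "x \<in> carrier (act_obj k B E \<rho> N Q)" for x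
    using *[of x] that by simp
qed

lemma tensor_map_id:
  assumes "u \<in> carrier (kgroup k E B)"
  shows "tensor_lift (kgroup k E B) (kpure k E B) u = u"
proof (rule kgroup_ext[OF sp_EB kgroup_abelian_group[OF sp_EB] _ _ _ assms])
  have id: "(\<lambda>x. x) \<in> linear k X X" for X
    by (auto simp: semilinear_def add_hom_def)
  note t = tensor_map_add_hom[OF sp_EB sp_EB id id] tensor_map_pure[OF sp_EB sp_EB id id]
  show "tensor_lift (kgroup k E B) (kpure k E B) \<in> add_hom (kgroup k E B) (kgroup k E B)"
    using t(1) by simp
  show "(\<lambda>u. u) \<in> add_hom (kgroup k E B) (kgroup k E B)"
    by (auto simp: add_hom_def)
  show "tensor_lift (kgroup k E B) (kpure k E B) (kpure k E B x y) = kpure k E B x y"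
    if "x \<in> carrier E" "y \<in> carrier B" for x y
    using t(2)[OF that] by simp
qed

lemma act_arr:
  assumes N: "left_module E N" and Q: "left_module B Q" and N': "left_module E N'" and Q': "left_module B Q'"
    and g: "g \<in> lmod_hom E N N'" and h: "h \<in> lmod_hom B Q Q'"
  shows act_arr_lmod_hom: "FArr (act k B E \<rho>) (N, Q) (N', Q') (g, h)
      \<in> lmod_hom E (act_obj k B E \<rho> N Q) (act_obj k B E \<rho> N' Q')"
    and act_arr_pure: "\<lbrakk>n \<in> carrier N; q \<in> carrier Q\<rbrakk> \<Longrightarrow>
      FArr (act k B E \<rho>) (N, Q) (N', Q') (g, h) (act_pure k B E N Q n q) = act_pure k B E N' Q' (g n) (h q)"
proof -
  have id: "algebra_map k E E (\<lambda>x. x)" "algebra_map k B B (\<lambda>x. x)"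
    by (auto simp: algebra_map_def ring_hom_def)
  note c = coaction_axioms
  note m = act_map[OF c c id _ N Q N' Q' lmod_hom_linear[OF g] lmod_hom_linear[OF h]]
  show "FArr (act k B E \<rho>) (N, Q) (N', Q') (g, h)
      \<in> lmod_hom E (act_obj k B E \<rho> N Q) (act_obj k B E \<rho> N' Q')"
    using restrict_linear_lmod_hom[OF left_module_act_obj[OF N Q] m(1)] by (simp add: tensor_map_id \<rho>_closed)
  show "FArr (act k B E \<rho>) (N, Q) (N', Q') (g, h) (act_pure k B E N Q n q) = act_pure k B E N' Q' (g n) (h q)"
    if "n \<in> carrier N" "q \<in> carrier Q"
    using m(2) that by (simp add: tensor_map_id \<rho>_closed act_pure_closed[OF N Q])
qed

lemma is_functor_act: "is_functor (prod_category (LMod E) (LMod B)) (LMod E) (act k B E \<rho>)"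
  unfolding is_functor_def
proof (intro conjI ballI; (intro is_category_prod is_category_LMod)?)
  fix X :: "('e, 'n) module \<times> ('b, 'q) module"
  assume "X \<in> Obj (prod_category (LMod E) (LMod B))"
  then obtain N Q where X: "X = (N, Q)" and N: "left_module E N" and Q: "left_module B Q"
    by (cases X) auto
  note NQ = left_module_act_obj[OF N Q]
  show "FObj (act k B E \<rho>) X \<in> Obj (LMod E)"
    using NQ by (simp add: X)
  note id = N Q N Q lmod_hom_ident[OF N] lmod_hom_ident[OF Q]
  have "FArr (act k B E \<rho>) (N, Q) (N, Q) (\<lambda>x\<in>carrier N. x, \<lambda>x\<in>carrier Q. x)
      = (\<lambda>w\<in>carrier (act_obj k B E \<rho> N Q). w)"
    by (rule act_lmod_hom_eqI[OF N Q NQ act_arr_lmod_hom[OF id] lmod_hom_ident[OF NQ]])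
      (simp add: act_arr_pure[OF id] act_pure_closed[OF N Q] del: act_simps(2))
  then show "FArr (act k B E \<rho>) X X (Ide (prod_category (LMod E) (LMod B)) X) = Ide (LMod E) (FObj (act k B E \<rho>) X)"
    by (simp add: X)
  fix Y :: "('e, 'n) module \<times> ('b, 'q) module"
  assume "Y \<in> Obj (prod_category (LMod E) (LMod B))"
  then obtain N' Q' where Y: "Y = (N', Q')" and N': "left_module E N'" and Q': "left_module B Q'"
    by (cases Y) auto
  fix h assume "h \<in> Arr (prod_category (LMod E) (LMod B)) X Y"
  then obtain g1 h1 where h: "h = (g1, h1)" and gh1: "g1 \<in> lmod_hom E N N'" "h1 \<in> lmod_hom B Q Q'"
    by (cases h) (auto simp: X Y)
  note 1 = N Q N' Q' gh1
  show "FArr (act k B E \<rho>) X Y h \<in> Arr (LMod E) (FObj (act k B E \<rho>) X) (FObj (act k B E \<rho>) Y)"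
    using act_arr_lmod_hom[OF 1] by (simp add: X Y h)
  fix Z :: "('e, 'n) module \<times> ('b, 'q) module"
  assume "Z \<in> Obj (prod_category (LMod E) (LMod B))"
  then obtain N'' Q'' where Z: "Z = (N'', Q'')" and N'': "left_module E N''" and Q'': "left_module B Q''"
    by (cases Z) auto
  fix l assume "l \<in> Arr (prod_category (LMod E) (LMod B)) Y Z"
  then obtain g2 h2 where l: "l = (g2, h2)" and gh2: "g2 \<in> lmod_hom E N' N''" "h2 \<in> lmod_hom B Q' Q''"
    by (cases l) (auto simp: Y Z)
  note 2 = N' Q' N'' Q'' gh2
  note 12 = N Q N'' Q'' lmod_hom_compose[OF N gh1(1) gh2(1)] lmod_hom_compose[OF Q gh1(2) gh2(2)]
  have "FArr (act k B E \<rho>) (N, Q) (N'', Q'') (compose (carrier N) g2 g1, compose (carrier Q) h2 h1)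
    = compose (carrier (act_obj k B E \<rho> N Q)) (FArr (act k B E \<rho>) (N', Q') (N'', Q'') (g2, h2))
        (FArr (act k B E \<rho>) (N, Q) (N', Q') (g1, h1))"
    by (rule act_lmod_hom_eqI[OF N Q left_module_act_obj[OF N'' Q''] act_arr_lmod_hom[OF 12]
          lmod_hom_compose[OF NQ act_arr_lmod_hom[OF 1] act_arr_lmod_hom[OF 2]]])
      (simp add: compose_eq act_arr_pure[OF 1] act_arr_pure[OF 2] act_arr_pure[OF 12] act_pure_closed[OF N Q]
        lmod_hom_closed[OF gh1(1)] lmod_hom_closed[OF gh1(2)] del: act_simps(2))
  then show "FArr (act k B E \<rho>) X Z (Cmp (prod_category (LMod E) (LMod B)) X Y Z l h)
    = Cmp (LMod E) (FObj (act k B E \<rho>) X) (FObj (act k B E \<rho>) Y) (FObj (act k B E \<rho>) Z)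
        (FArr (act k B E \<rho>) Y Z l) (FArr (act k B E \<rho>) X Y h)"
    by (simp add: X Y Z h l)
qed

end

section \<open>The canonical natural transformation\<close>

text \<open>The map \<open>\<eta>\<^sub>N \<otimes> \<eta>\<^sub>Q : N \<otimes> Q \<rightarrow> f\<^sup>*N \<otimes> \<phi>\<^sup>*Q\<close>.\<close>

definition unit_tensor ::
    "('k, 'c) ring_scheme \<Rightarrow> ('k, 'b, 'd) module_scheme \<Rightarrow> ('k, 'b1, 'd1) module_scheme \<Rightarrow> ('b \<Rightarrow> 'b1)
      \<Rightarrow> ('k, 'e, 'z) module_scheme \<Rightarrow> ('k, 'e1, 'z1) module_scheme \<Rightarrow> ('e \<Rightarrow> 'e1)
      \<Rightarrow> ('e, 'n) module \<Rightarrow> ('b, 'q) module \<Rightarrow> ('n, 'q) tens \<Rightarrow> (('e1, 'n) tens, ('b1, 'q) tens) tens" where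
  "unit_tensor k B B' \<phi> E E' f N Q =
     tensor_lift (act_group k B' E' (ext_obj E E' f N) (ext_obj B B' \<phi> Q))
       (\<lambda>n q. act_pure k B' E' (ext_obj E E' f N) (ext_obj B B' \<phi> Q)
         (ext_unit E E' f N n) (ext_unit B B' \<phi> Q q))"

text \<open>The adjunct of \<open>unit_tensor\<close> under the adjunction between extension and restriction of scalars.\<close>

definition act_ext_compare ::
    "('k, 'c) ring_scheme \<Rightarrow> ('k, 'b, 'd) module_scheme \<Rightarrow> ('k, 'b1, 'd1) module_scheme \<Rightarrow> ('b \<Rightarrow> 'b1)
      \<Rightarrow> ('k, 'e, 'z) module_scheme \<Rightarrow> ('e \<Rightarrow> ('e, 'b) tens)
      \<Rightarrow> ('k, 'e1, 'z1) module_scheme \<Rightarrow> ('e1 \<Rightarrow> ('e1, 'b1) tens) \<Rightarrow> ('e \<Rightarrow> 'e1)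
      \<Rightarrow> ('e, 'n) module \<times> ('b, 'q) module \<Rightarrow> ('e1, ('n, 'q) tens) tens
      \<Rightarrow> (('e1, 'n) tens, ('b1, 'q) tens) tens" where
  "act_ext_compare k B B' \<phi> E \<rho> E' \<rho>' f X =
     (let P = act_obj k B' E' \<rho>' (ext_obj E E' f (fst X)) (ext_obj B B' \<phi> (snd X)) in
       restrict (tensor_lift P (\<lambda>x w. x \<odot>\<^bsub>P\<^esub> unit_tensor k B B' \<phi> E E' f (fst X) (snd X) w))
         (carrier (ext_obj E E' f (act_obj k B E \<rho> (fst X) (snd X)))))"

locale coaction_map = E: coaction k B E \<rho> + E': coaction k B' E' \<rho>'
  for k :: "('k, 'c) ring_scheme" and B :: "('k, 'b, 'd) module_scheme"
    and E :: "('k, 'e, 'z) module_scheme" and \<rho> :: "'e \<Rightarrow> ('e, 'b) tens"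
    and B' :: "('k, 'b1, 'd1) module_scheme"
    and E' :: "('k, 'e1, 'z1) module_scheme" and \<rho>' :: "'e1 \<Rightarrow> ('e1, 'b1) tens"
    and \<phi> :: "'b \<Rightarrow> 'b1" and f :: "'e \<Rightarrow> 'e1" +
  assumes \<phi>: "algebra_map k B B' \<phi>" and f: "algebra_map k E E' f"
    and \<rho>f: "\<And>e. e \<in> carrier E \<Longrightarrow>
      \<rho>' (f e) = tensor_lift (kgroup k E' B') (\<lambda>e0 e1. kpure k E' B' (f e0) (\<phi> e1)) (\<rho> e)"
begin

sublocale fE: scalar_ext E E' f
  using f by unfold_locales (simp add: algebra_map_def)

sublocale \<phi>B: scalar_ext B B' \<phi>
  using \<phi> by unfold_locales (simp add: algebra_map_def)

abbreviation "fN \<equiv> ext_obj E E' f"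
abbreviation "\<phi>Q \<equiv> ext_obj B B' \<phi>"
abbreviation "\<theta> \<equiv> unit_tensor k B B' \<phi> E E' f"
abbreviation "\<alpha> \<equiv> act_ext_compare k B B' \<phi> E \<rho> E' \<rho>' f"
abbreviation "NQ \<equiv> act_obj k B E \<rho>"
abbreviation "P N Q \<equiv> act_obj k B' E' \<rho>' (fN N) (\<phi>Q Q)"

lemma left_module_P: "\<lbrakk>left_module E N; left_module B Q\<rbrakk> \<Longrightarrow> left_module E' (P N Q)"
  by (intro E'.left_module_act_obj fE.left_module_ext_obj \<phi>B.left_module_ext_obj)

lemma unit_tensor:
  assumes N: "left_module E N" and Q: "left_module B Q"
  shows unit_tensor_semilinear: "\<theta> N Q \<in> semilinear E f (NQ N Q) (P N Q)"
    and unit_tensor_pure: "\<lbrakk>n \<in> carrier N; q \<in> carrier Q\<rbrakk> \<Longrightarrow> \<theta> N Q (act_pure k B E N Q n q)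
      = act_pure k B' E' (fN N) (\<phi>Q Q) (ext_unit E E' f N n) (ext_unit B B' \<phi> Q q)"
  unfolding unit_tensor_def[abs_def]
  using act_map[OF E.coaction_axioms E'.coaction_axioms f \<phi> \<rho>f N Q fE.left_module_ext_obj[OF N]
      \<phi>B.left_module_ext_obj[OF Q] fE.ext_unit_semilinear[OF N] \<phi>B.ext_unit_semilinear[OF Q]]
  by simp_all

lemma act_ext_compare:
  assumes N: "left_module E N" and Q: "left_module B Q"
  shows act_ext_compare_lmod_hom: "\<alpha> (N, Q) \<in> lmod_hom E' (fN (NQ N Q)) (P N Q)"
    and act_ext_compare_unit: "w \<in> carrier (NQ N Q) \<Longrightarrow> \<alpha> (N, Q) (ext_unit E E' f (NQ N Q) w) = \<theta> N Q w"
proof -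
  note NQ = E.left_module_act_obj[OF N Q]
  note a = fE.ext_adjunct[OF NQ left_module_P[OF N Q] unit_tensor_semilinear[OF N Q]]
  show "\<alpha> (N, Q) \<in> lmod_hom E' (fN (NQ N Q)) (P N Q)"
    using restrict_linear_lmod_hom[OF fE.left_module_ext_obj[OF NQ] a(1)]
    by (simp add: act_ext_compare_def Let_def)
  show "\<alpha> (N, Q) (ext_unit E E' f (NQ N Q) w) = \<theta> N Q w" if "w \<in> carrier (NQ N Q)"
    using a(2)[OF that] fE.ext_unit_closed[OF NQ that] by (simp add: act_ext_compare_def Let_def)
qed

lemma act_ext_compare_natural:
  assumes N: "left_module E N" and Q: "left_module B Q" and N': "left_module E N'" and Q': "left_module B Q'"
    and g: "g \<in> lmod_hom E N N'" and h: "h \<in> lmod_hom B Q Q'"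
  shows "compose (carrier (fN (NQ N Q))) (\<alpha> (N', Q'))
      (FArr (ext_scalars E E' f) (NQ N Q) (NQ N' Q') (FArr (act k B E \<rho>) (N, Q) (N', Q') (g, h)))
    = compose (carrier (fN (NQ N Q)))
      (FArr (act k B' E' \<rho>') (fN N, \<phi>Q Q) (fN N', \<phi>Q Q')
        (FArr (ext_scalars E E' f) N N' g, FArr (ext_scalars B B' \<phi>) Q Q' h))
      (\<alpha> (N, Q))"
proof -
  let ?C = "carrier (fN (NQ N Q))"
  let ?gh = "FArr (act k B E \<rho>) (N, Q) (N', Q') (g, h)"
  let ?f = "FArr (ext_scalars E E' f) (NQ N Q) (NQ N' Q')"
  let ?r = "FArr (act k B' E' \<rho>') (fN N, \<phi>Q Q) (fN N', \<phi>Q Q')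
    (FArr (ext_scalars E E' f) N N' g, FArr (ext_scalars B B' \<phi>) Q Q' h)"
  note NQ = E.left_module_act_obj[OF N Q] and NQ' = E.left_module_act_obj[OF N' Q']
  note P = left_module_P[OF N Q] and P' = left_module_P[OF N' Q']
  note gh = E.act_arr_lmod_hom[OF N Q N' Q' g h]
  note fgh = fE.ext_arr_lmod_hom[OF NQ NQ' gh]
  note rargs = fE.left_module_ext_obj[OF N] \<phi>B.left_module_ext_obj[OF Q]
    fE.left_module_ext_obj[OF N'] \<phi>B.left_module_ext_obj[OF Q']
    fE.ext_arr_lmod_hom[OF N N' g] \<phi>B.ext_arr_lmod_hom[OF Q Q' h]
  note r = E'.act_arr_lmod_hom[OF rargs]
  \<comment> \<open>Both sides of the naturality square are linear, so it suffices to compare them on \<open>1 \<otimes> w\<close>, where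
    the transformation becomes \<open>\<theta>\<close>.\<close>
  have \<theta>_natural: "\<theta> N' Q' (?gh w) = ?r (\<theta> N Q w)" if "w \<in> carrier (NQ N Q)" for w
  proof (rule E.act_group_ext[OF N Q left_module_abelian_group[OF P']])
    show "w \<in> carrier (act_group k B E N Q)"
      using that by simp
    have "(\<lambda>w. \<theta> N' Q' (?gh w)) \<in> add_hom (NQ N Q) (P N' Q')"
      by (rule add_hom_comp[OF semilinear_add_hom[OF lmod_hom_linear[OF gh]]
            semilinear_add_hom[OF unit_tensor_semilinear[OF N' Q']]])
    then show "(\<lambda>w. \<theta> N' Q' (?gh w)) \<in> add_hom (act_group k B E N Q) (P N' Q')"
      by (simp add: add_hom_def del: act_simps(2))
    have "(\<lambda>w. ?r (\<theta> N Q w)) \<in> add_hom (NQ N Q) (P N' Q')"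
      by (rule add_hom_comp[OF semilinear_add_hom[OF unit_tensor_semilinear[OF N Q]]
            semilinear_add_hom[OF lmod_hom_linear[OF r]]])
    then show "(\<lambda>w. ?r (\<theta> N Q w)) \<in> add_hom (act_group k B E N Q) (P N' Q')"
      by (simp add: add_hom_def del: act_simps(2) ext_scalars_simps(2))
  next
    fix n q assume nq: "n \<in> carrier N" "q \<in> carrier Q"
    have u: "ext_unit E E' f N n \<in> carrier (fN N)" "ext_unit B B' \<phi> Q q \<in> carrier (\<phi>Q Q)"
      using fE.ext_unit_closed[OF N nq(1)] \<phi>B.ext_unit_closed[OF Q nq(2)] by simp_all
    have "\<theta> N' Q' (?gh (act_pure k B E N Q n q)) = act_pure k B' E' (fN N') (\<phi>Q Q')
        (ext_unit E E' f N' (g n)) (ext_unit B B' \<phi> Q' (h q))"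
      unfolding E.act_arr_pure[OF N Q N' Q' g h nq]
      by (rule unit_tensor_pure[OF N' Q' lmod_hom_closed[OF g nq(1)] lmod_hom_closed[OF h nq(2)]])
    also have "\<dots> = ?r (\<theta> N Q (act_pure k B E N Q n q))"
      unfolding unit_tensor_pure[OF N Q nq] E'.act_arr_pure[OF rargs u]
        fE.ext_arr_unit[OF N N' g nq(1)] \<phi>B.ext_arr_unit[OF Q Q' h nq(2)] ..
    finally show "\<theta> N' Q' (?gh (act_pure k B E N Q n q)) = ?r (\<theta> N Q (act_pure k B E N Q n q))" .
  qed
  show ?thesis
  proof (rule fE.ext_lmod_hom_eqI[OF NQ P'
        lmod_hom_compose[OF fE.left_module_ext_obj[OF NQ] fgh act_ext_compare_lmod_hom[OF N' Q']]
        lmod_hom_compose[OF fE.left_module_ext_obj[OF NQ] act_ext_compare_lmod_hom[OF N Q] r]])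
    fix w assume w: "w \<in> carrier (NQ N Q)"
    have u: "ext_unit E E' f (NQ N Q) w \<in> ?C"
      using fE.ext_unit_closed[OF NQ w] by simp
    show "compose ?C (\<alpha> (N', Q')) (?f ?gh) (ext_unit E E' f (NQ N Q) w)
        = compose ?C ?r (\<alpha> (N, Q)) (ext_unit E E' f (NQ N Q) w)"
      unfolding compose_eq[OF u] fE.ext_arr_unit[OF NQ NQ' gh w] act_ext_compare_unit[OF N Q w]
        act_ext_compare_unit[OF N' Q' lmod_hom_closed[OF gh w]]
      by (rule \<theta>_natural[OF w])
  qed
qed

lemma act_ext_compare_nat_trans:
  "module_nat_trans (prod_category (LMod E) (LMod B)) E'
      (ext_scalars E E' f \<circ>\<^sub>F act k B E \<rho>)
      (act k B' E' \<rho>' \<circ>\<^sub>F (ext_scalars E E' f \<times>\<^sub>F ext_scalars B B' \<phi>)) \<alpha>"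
  unfolding module_nat_trans_def
proof (intro conjI ballI)
  show "is_functor (prod_category (LMod E) (LMod B)) (LMod E') (ext_scalars E E' f \<circ>\<^sub>F act k B E \<rho>)"
    by (rule is_functor_comp[OF fE.is_functor_ext_scalars E.is_functor_act])
  show "is_functor (prod_category (LMod E) (LMod B)) (LMod E')
      (act k B' E' \<rho>' \<circ>\<^sub>F (ext_scalars E E' f \<times>\<^sub>F ext_scalars B B' \<phi>))"
    by (rule is_functor_comp[OF E'.is_functor_act
          is_functor_prod[OF fE.is_functor_ext_scalars \<phi>B.is_functor_ext_scalars]])
next
  fix X assume "X \<in> Obj (prod_category (LMod E) (LMod B))"
  then show "\<alpha> X \<in> lmod_hom E' (FObj (ext_scalars E E' f \<circ>\<^sub>F act k B E \<rho>) X)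
      (FObj (act k B' E' \<rho>' \<circ>\<^sub>F (ext_scalars E E' f \<times>\<^sub>F ext_scalars B B' \<phi>)) X)"
    using act_ext_compare_lmod_hom[of "fst X" "snd X"] by auto
next
  fix X Y gh
  assume "X \<in> Obj (prod_category (LMod E) (LMod B))" "Y \<in> Obj (prod_category (LMod E) (LMod B))"
    "gh \<in> Arr (prod_category (LMod E) (LMod B)) X Y"
  then show "compose (carrier (FObj (ext_scalars E E' f \<circ>\<^sub>F act k B E \<rho>) X)) (\<alpha> Y)
      (FArr (ext_scalars E E' f \<circ>\<^sub>F act k B E \<rho>) X Y gh)
    = compose (carrier (FObj (ext_scalars E E' f \<circ>\<^sub>F act k B E \<rho>) X))
      (FArr (act k B' E' \<rho>' \<circ>\<^sub>F (ext_scalars E E' f \<times>\<^sub>F ext_scalars B B' \<phi>)) X Y gh) (\<alpha> X)"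
    using act_ext_compare_natural[of "fst X" "snd X" "fst Y" "snd Y" "fst gh" "snd gh"]
    by (auto simp del: act_simps(2) ext_scalars_simps(2))
qed

lemma act_ext_compare_unit_pure:
  assumes N: "left_module E N" and Q: "left_module B Q" and nq: "n \<in> carrier N" "q \<in> carrier Q"
  shows "\<alpha> (N, Q) (ext_unit E E' f (NQ N Q) (act_pure k B E N Q n q))
       = act_pure k B' E' (fN N) (\<phi>Q Q) (ext_unit E E' f N n) (ext_unit B B' \<phi> Q q)"
  using act_ext_compare_unit[OF N Q, of "act_pure k B E N Q n q"] E.act_pure_closed[OF N Q nq] unit_tensor_pure[OF N Q nq] by simp

end


theorem mainTheorem1:
  fixes k :: "'k ring"
    and B :: "('k, 'b) bialgebra" and B' :: "('k, 'b1) bialgebra" and \<phi> :: "'b \<Rightarrow> 'b1"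
    and E :: "('k, 'e) module" and \<rho> :: "'e \<Rightarrow> ('e, 'b) tens"
    and E' :: "('k, 'e1) module" and \<rho>' :: "'e1 \<Rightarrow> ('e1, 'b1) tens"
    and f :: "'e \<Rightarrow> 'e1"
  assumes "field k"
    and "is_bialgebra k B" and "is_bialgebra k B'" and "bialgebra_map k B B' \<phi>"
    and "comodule_algebra k B E \<rho>" and "comodule_algebra k B' E' \<rho>'"
    and "comodule_algebra_map k B' E \<rho> E' \<rho>' \<phi> f"
  shows "\<exists>\<alpha> :: ('e, 'n) module \<times> ('b, 'q) module
            \<Rightarrow> ('e1, ('n, 'q) tens) tens \<Rightarrow> (('e1, 'n) tens, ('b1, 'q) tens) tens.
    module_nat_trans (prod_category (LMod E) (LMod B)) E'
      (ext_scalars E E' f \<circ>\<^sub>F act k B E \<rho>)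
      (act k B' E' \<rho>' \<circ>\<^sub>F (ext_scalars E E' f \<times>\<^sub>F ext_scalars B B' \<phi>))
      \<alpha> \<and>
    (\<forall>N\<in>Obj (LMod E). \<forall>Q\<in>Obj (LMod B). \<forall>n\<in>carrier N. \<forall>q\<in>carrier Q.
       \<alpha> (N, Q) (ext_unit E E' f (act_obj k B E \<rho> N Q) (act_pure k B E N Q n q))
       = act_pure k B' E' (ext_obj E E' f N) (ext_obj B B' \<phi> Q)
           (ext_unit E E' f N n) (ext_unit B B' \<phi> Q q))"



proof (intro exI conjI ballI)
  interpret coaction_map k B E \<rho> B' E' \<rho>' \<phi> f
    using assms(2-)
    by unfold_locales (auto simp: is_bialgebra_def bialgebra_map_def comodule_algebra_def comodule_algebra_map_def)
  show "module_nat_trans (prod_category (LMod E) (LMod B)) E'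
      (ext_scalars E E' f \<circ>\<^sub>F act k B E \<rho>)
      (act k B' E' \<rho>' \<circ>\<^sub>F (ext_scalars E E' f \<times>\<^sub>F ext_scalars B B' \<phi>))
      (act_ext_compare k B B' \<phi> E \<rho> E' \<rho>' f)"
    by (rule act_ext_compare_nat_trans)
  show "act_ext_compare k B B' \<phi> E \<rho> E' \<rho>' f (N, Q)
      (ext_unit E E' f (act_obj k B E \<rho> N Q) (act_pure k B E N Q n q))
    = act_pure k B' E' (ext_obj E E' f N) (ext_obj B B' \<phi> Q)
        (ext_unit E E' f N n) (ext_unit B B' \<phi> Q q)"
    if "N \<in> Obj (LMod E)" "Q \<in> Obj (LMod B)" "n \<in> carrier N" "q \<in> carrier Q" for N Q n q
    using act_ext_compare_unit_pure that by simp
qed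

end
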